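(* If $G$ is an outerplanar graph with maximum degree $\Delta(G)=3$, then $\chi'_{\mathrm{inj}}(G)\leq 5$. Moreover, the bound is tight: there exists an outerplanar graph $G$ with $\Delta(G)=3$ and $\chi'_{\mathrm{inj}}(G)=5$.
   Context: All graphs are finite and simple. An outerplanar graph is a graph with a planar drawing for which all vertices belong to the outer face of the drawing. Three edges $e_1,e_2,e_3$ of a graph are consecutive if they form (in this order) a path of length three or a cycle of length three. An injective edge-coloring of $G$ with $k$ colors is a map $c:E(G)\to\{1,\dots,k\}$ (not necessarily a proper edge-coloring) such that $c(e_1)\neq c(e_3)$ whenever $e_1,e_2,e_3$ are consecutive edges in $G$. The injective chromatic index $\chi'_{\mathrm{inj}}(G)$ is the minimum $k$ such that $G$ has an injective edge-coloring with $k$ colors. *)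

theory Defs
  imports "HOL-Analysis.Analysis"
begin

text \<open>
  A graph is given by a vertex set \<open>V\<close> and a set \<open>E\<close> of edges, an edge being the
  two-element set of its endpoints.
\<close>

locale fin_simple_graph =
  fixes V :: "'a set" and E :: "'a set set"
  assumes finite_vertices: "finite V"
    and edges: "e \<in> E \<Longrightarrow> e \<subseteq> V \<and> card e = 2"
begin

lemma finite_edges: "finite E"
  using finite_vertices edges by (meson Pow_iff finite_Pow_iff finite_subset subsetI)

end

definition vertex_degree :: "'a set set \<Rightarrow> 'a \<Rightarrow> nat" where
  "vertex_degree E v = card {e \<in> E. v \<in> e}"

text \<open>On \<^typ>\<open>nat\<close> the supremum of the empty set is 0, so the null graph has maximum degree 0.\<close>

definition max_degree :: "'a set \<Rightarrow> 'a set set \<Rightarrow> nat" where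
  "max_degree V E = (SUP v\<in>V. vertex_degree E v)"

text \<open>
  The plane is \<^typ>\<open>complex\<close>. In a planar drawing, \<open>p\<close> places the vertices and
  \<open>\<gamma> e\<close> is a simple arc joining the endpoints of \<open>e\<close>. An arc meets no vertex
  other than its endpoints, and two arcs meet only in common endpoints.
\<close>

definition planar_drawing ::
  "'a set \<Rightarrow> 'a set set \<Rightarrow> ('a \<Rightarrow> complex) \<Rightarrow> ('a set \<Rightarrow> real \<Rightarrow> complex) \<Rightarrow> bool" where
  "planar_drawing V E p \<gamma> \<longleftrightarrow>
     inj_on p V \<and>
     (\<forall>e\<in>E. arc (\<gamma> e) \<and> {pathstart (\<gamma> e), pathfinish (\<gamma> e)} = p ` e \<and>
        path_image (\<gamma> e) \<inter> p ` V = p ` e) \<and>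
     (\<forall>e\<in>E. \<forall>f\<in>E. e \<noteq> f \<longrightarrow> path_image (\<gamma> e) \<inter> path_image (\<gamma> f) = p ` (e \<inter> f))"

definition drawing_points ::
  "'a set \<Rightarrow> 'a set set \<Rightarrow> ('a \<Rightarrow> complex) \<Rightarrow> ('a set \<Rightarrow> real \<Rightarrow> complex) \<Rightarrow> complex set" where
  "drawing_points V E p \<gamma> = p ` V \<union> (\<Union>e\<in>E. path_image (\<gamma> e))"

text \<open>
  The faces are the components of the complement of the drawing. As the drawing is compact, exactly
  one of them is unbounded, and this outer face is \<^const>\<open>outside\<close> of the drawing. A vertex
  belongs to a face if it lies on the boundary of that face.
\<close>

definition outerplanar :: "'a set \<Rightarrow> 'a set set \<Rightarrow> bool" where
  "outerplanar V E \<longleftrightarrow>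
     (\<exists>p \<gamma>. planar_drawing V E p \<gamma> \<and> p ` V \<subseteq> frontier (outside (drawing_points V E p \<gamma>)))"

definition consecutive :: "'a set set \<Rightarrow> 'a set \<Rightarrow> 'a set \<Rightarrow> 'a set \<Rightarrow> bool" where
  "consecutive E e1 e2 e3 \<longleftrightarrow>
     e1 \<in> E \<and> e2 \<in> E \<and> e3 \<in> E \<and>
     ((\<exists>a b c d. distinct [a, b, c, d] \<and> e1 = {a, b} \<and> e2 = {b, c} \<and> e3 = {c, d}) \<or>
      (\<exists>a b c. distinct [a, b, c] \<and> e1 = {a, b} \<and> e2 = {b, c} \<and> e3 = {c, a}))"

definition injective_edge_coloring :: "'a set set \<Rightarrow> nat \<Rightarrow> ('a set \<Rightarrow> nat) \<Rightarrow> bool" where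
  "injective_edge_coloring E k c \<longleftrightarrow>
     c \<in> E \<rightarrow> {1..k} \<and> (\<forall>e1 e2 e3. consecutive E e1 e2 e3 \<longrightarrow> c e1 \<noteq> c e3)"

definition injective_chromatic_index :: "'a set set \<Rightarrow> nat" where
  "injective_chromatic_index E = (LEAST k. \<exists>c. injective_edge_coloring E k c)"

text \<open>In a finite simple graph the minimum is attained.\<close>

lemma (in fin_simple_graph) injective_chromatic_index_attained:
  "\<exists>c. injective_edge_coloring E (injective_chromatic_index E) c"
proof -
  obtain c where c: "bij_betw c E {1..card E}"
    using finite_edges ex_bij_betw_finite_nat[OF finite_edges]
    by (metis card_atLeastAtMost diff_Suc_1 finite_atLeastAtMost finite_same_card_bij)
  have "c e1 \<noteq> c e3" if "consecutive E e1 e2 e3" for e1 e2 e3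
  proof -
    have "e1 \<in> E" "e3 \<in> E" "e1 \<noteq> e3"
      using that by (auto simp: consecutive_def doubleton_eq_iff)
    then show ?thesis
      using c by (meson bij_betw_def inj_onD)
  qed
  then have "injective_edge_coloring E (card E) c"
    using c by (auto simp: injective_edge_coloring_def bij_betw_def)
  then show ?thesis
    unfolding injective_chromatic_index_def
    by (intro LeastI[where P = "\<lambda>k. \<exists>c. injective_edge_coloring E k c"] exI)
qed

end

theory Submission
  imports Defs
begin

text \<open>
  Write \<open>A u\<close> for the set of edges at \<open>u\<close>. A colouring is injective iff for every edge \<open>uv\<close> the
  colours on \<open>A u - {uv}\<close> and on \<open>A v - {uv}\<close> are disjoint, so a bridge only transmits its own colour
  and the colours next to it. The bound is proved by induction on the number of edges, with part of the
  colouring at a root vertex prescribed. If the component of the root is not a star of leaves, either it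
  splits at a bridge, or the root lies on a cycle, and a longest one through it meets all edges: an ear
  would give a longer cycle, or three internally disjoint paths with inner vertices between two vertices,
  which contradicts outerplanarity. The chords of that cycle are pairwise noncrossing by outerplanarity
  and disjoint by the degree bound. Such a polygon is coloured from the outside in: cutting along a chord
  leaves a strip whose two end edges are already coloured, and almost all prescriptions at the ends of a
  strip extend.

  For tightness, two copies of a graph with six vertices are joined by a bridge. With four colours, each
  copy forces the colour of the bridge to reappear on another edge at the bridge's end in that copy,
  which is impossible at both ends.
\<close>

section \<open>Theta curves\<close>

text \<open>The two patterns that outerplanarity excludes are inherited by subsets of the edges, so
  once they are derived from a drawing the induction never returns to one. A plain induction fails
  at a bridge: the side that is coloured second must respect what is already fixed across the
  bridge. In a subcubic graph this is the colour of the bridge and at most two colours next to it,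
  while the end of the bridge keeps at most two other edges. Hence the prescription
  \<open>d\<close>, \<open>S\<close> with at most two colours in \<open>S\<close>, at a root with at
  most two edges; cutting at another bridge reproduces this shape. If such a root lies on a cycle,
  it has no chord, and the bridge acts like a pendant edge there. With five colours a greedy choice
  succeeds as long as at most four values are forbidden. The critical place is a chord with hardly
  any room beyond it, where five values would have to be avoided; there coincidences among the
  prescribed colours have to be exploited.\<close>

locale theta_curve =
  fixes c1 c2 c3 :: "real \<Rightarrow> complex" and a b :: complex
  assumes arcs: "arc c1" "arc c2" "arc c3"
    and ends: "pathstart c1 = a" "pathfinish c1 = b" "pathstart c2 = a" "pathfinish c2 = b"
      "pathstart c3 = a" "pathfinish c3 = b"
    and meet: "path_image c1 \<inter> path_image c2 = {a, b}" "path_image c1 \<inter> path_image c3 = {a, b}"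
      "path_image c2 \<inter> path_image c3 = {a, b}"
begin

lemma ends_neq: "a \<noteq> b"
  using arc_distinct_ends[OF arcs(1)] ends by simp

lemma rotate: "theta_curve c2 c3 c1 a b"
  by (rule theta_curve.intro) (simp_all add: arcs ends meet Int_commute)

lemma swap: "theta_curve c2 c1 c3 a b"
  by (rule theta_curve.intro) (simp_all add: arcs ends meet Int_commute)

lemma Jordan_union:
  shows "open (inside (path_image c1 \<union> path_image c2))" "connected (inside (path_image c1 \<union> path_image c2))"
    "inside (path_image c1 \<union> path_image c2) \<noteq> {}"
    "frontier (inside (path_image c1 \<union> path_image c2)) = path_image c1 \<union> path_image c2"
    "open (outside (path_image c1 \<union> path_image c2))" "connected (outside (path_image c1 \<union> path_image c2))"
proof -
  let ?c = "c1 +++ reversepath c2"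
  have "simple_path ?c"
    by (rule simple_path_join_loop) (use arcs ends meet in \<open>auto simp: arc_reversepath\<close>)
  moreover have "pathfinish ?c = pathstart ?c" using ends by simp
  moreover have "path_image ?c = path_image c1 \<union> path_image c2"
    using ends by (simp add: path_image_join)
  ultimately show "open (inside (path_image c1 \<union> path_image c2))" "connected (inside (path_image c1 \<union> path_image c2))"
    "inside (path_image c1 \<union> path_image c2) \<noteq> {}"
    "frontier (inside (path_image c1 \<union> path_image c2)) = path_image c1 \<union> path_image c2"
    "open (outside (path_image c1 \<union> path_image c2))" "connected (outside (path_image c1 \<union> path_image c2))"
    using Jordan_inside_outside[of ?c] by simp_all
qed

lemma split_inside:
  assumes "path_image c3 \<inter> inside (path_image c1 \<union> path_image c2) \<noteq> {}"
  shows "inside (path_image c1 \<union> path_image c3) \<inter> inside (path_image c2 \<union> path_image c3) = {}"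
    "inside (path_image c1 \<union> path_image c3) \<union> inside (path_image c2 \<union> path_image c3) \<union>
       (path_image c3 - {a, b}) = inside (path_image c1 \<union> path_image c2)"
proof -
  have "simple_path c1" "simple_path c2" "simple_path c3" using arcs by (simp_all add: arc_imp_simple_path)
  from split_inside_simple_closed_curve[OF this(1) ends(1,2) this(2) ends(3,4) this(3) ends(5,6) ends_neq meet assms]
  show "inside (path_image c1 \<union> path_image c3) \<inter> inside (path_image c2 \<union> path_image c3) = {}"
    "inside (path_image c1 \<union> path_image c3) \<union> inside (path_image c2 \<union> path_image c3) \<union>
       (path_image c3 - {a, b}) = inside (path_image c1 \<union> path_image c2)"
    by blast+
qed

lemma compact_images: "compact (path_image c1)" "compact (path_image c2)" "compact (path_image c3)"
  using arcs by (simp_all add: arc_imp_path compact_path_image)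

text \<open>Otherwise each of the two bounded regions, being connected and free of the boundary of
  the other, would contain the other. Equal regions have equal frontiers, so \<open>c2\<close> would
  shrink to its two ends.\<close>

lemma inside_in_outside:
  assumes "path_image c3 \<inter> inside (path_image c1 \<union> path_image c2) = {}"
    and "path_image c2 \<inter> inside (path_image c1 \<union> path_image c3) = {}"
    and "z \<in> inside (path_image c1 \<union> path_image c2)"
  shows "z \<in> outside (path_image c1 \<union> path_image c3)"
proof (rule ccontr)
  interpret t: theta_curve c1 c3 c2 a b
    by (rule theta_curve.intro) (simp_all add: arcs ends meet Int_commute)
  let ?A = "inside (path_image c1 \<union> path_image c2)" and ?B = "inside (path_image c1 \<union> path_image c3)"
  assume "z \<notin> outside (path_image c1 \<union> path_image c3)"
  moreover have "z \<notin> path_image c1 \<union> path_image c3"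
    using assms inside_no_overlap[of "path_image c1 \<union> path_image c2"] by blast
  ultimately have zB: "z \<in> ?B" using inside_Un_outside by fastforce
  have "?A \<subseteq> ?B"
  proof -
    have "?A \<inter> (path_image c1 \<union> path_image c3) = {}"
      using assms(1) inside_no_overlap[of "path_image c1 \<union> path_image c2"] by blast
    then have "?A \<subseteq> ?B \<union> outside (path_image c1 \<union> path_image c3)"
      using inside_Un_outside by fastforce
    then show ?thesis
      using connectedD[OF Jordan_union(2) t.Jordan_union(1) t.Jordan_union(5)] zB assms(3)
        inside_Int_outside[of "path_image c1 \<union> path_image c3"] by blast
  qed
  moreover have "?B \<subseteq> ?A"
  proof -
    have "?B \<inter> (path_image c1 \<union> path_image c2) = {}"
      using assms(2) inside_no_overlap[of "path_image c1 \<union> path_image c3"] by blast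
    then have "?B \<subseteq> ?A \<union> outside (path_image c1 \<union> path_image c2)"
      using inside_Un_outside by fastforce
    then show ?thesis
      using connectedD[OF t.Jordan_union(2) Jordan_union(1) Jordan_union(5)] zB assms(3)
        inside_Int_outside[of "path_image c1 \<union> path_image c2"] by blast
  qed
  ultimately have "?A = ?B" by (rule subset_antisym)
  then have "frontier ?A = frontier ?B" by (rule arg_cong)
  then have "path_image c1 \<union> path_image c2 = path_image c1 \<union> path_image c3"
    unfolding Jordan_union(4) t.Jordan_union(4) .
  then have "path_image c2 \<subseteq> {a, b}" using meet by blast
  then have "finite (path_image c2)" using finite_subset by blast
  moreover have "connected (path_image c2)" using arcs by (simp add: connected_path_image arc_imp_path)
  moreover have "a \<in> path_image c2" "b \<in> path_image c2" using meet by blast+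
  ultimately show False using connected_finite_iff_sing[of "path_image c2"] ends_neq by auto
qed

text \<open>
  Otherwise, take a point inside the first two arcs and a point outside all three. Neither the first and
  third nor the second and third arc separate these points, and the two unions meet in the connected third
  arc, so by Janiszewski's theorem the theta curve does not separate them, whereas its first two arcs do.
\<close>

lemma some_inside:
  "path_image c1 \<inter> inside (path_image c2 \<union> path_image c3) \<noteq> {} \<or>
   path_image c2 \<inter> inside (path_image c1 \<union> path_image c3) \<noteq> {} \<or>
   path_image c3 \<inter> inside (path_image c1 \<union> path_image c2) \<noteq> {}"
proof (rule ccontr)
  interpret s: theta_curve c2 c1 c3 a b by (rule swap)
  assume neg: "\<not> ?thesis"
  obtain z where z: "z \<in> inside (path_image c1 \<union> path_image c2)" using Jordan_union(3) by blast
  have z1: "z \<in> outside (path_image c1 \<union> path_image c3)"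
    using inside_in_outside z neg by blast
  have z2: "z \<in> outside (path_image c2 \<union> path_image c3)"
    using s.inside_in_outside[of z] z neg by (simp add: Un_commute)
  let ?T = "path_image c1 \<union> path_image c2 \<union> path_image c3"
  have "compact ?T" using compact_images by blast
  then have "bounded ?T" by (rule compact_imp_bounded)
  then have "outside ?T \<noteq> {}" by (simp add: outside_bounded_nonempty)
  then obtain w where w: "w \<in> outside ?T" by blast
  have w12: "w \<in> outside (path_image c1 \<union> path_image c2)" "w \<in> outside (path_image c1 \<union> path_image c3)"
    "w \<in> outside (path_image c2 \<union> path_image c3)"
    using w outside_mono[of "path_image c1 \<union> path_image c2" ?T] outside_mono[of "path_image c1 \<union> path_image c3" ?T]
      outside_mono[of "path_image c2 \<union> path_image c3" ?T] by auto
  have conn: "connected_component (- (path_image d \<union> path_image e)) z w"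
    if "theta_curve d e f a b" "z \<in> outside (path_image d \<union> path_image e)" "w \<in> outside (path_image d \<union> path_image e)" for d e f
  proof -
    interpret u: theta_curve d e f a b by (rule that(1))
    show ?thesis
      using u.Jordan_union(6) that(2,3) outside_no_overlap[of "path_image d \<union> path_image e"]
      unfolding connected_component_def by blast
  qed
  have "connected_component (- ((path_image c1 \<union> path_image c3) \<union> (path_image c2 \<union> path_image c3))) z w"
  proof (rule Janiszewski)
    show "compact (path_image c1 \<union> path_image c3)" using compact_images by blast
    show "closed (path_image c2 \<union> path_image c3)" using compact_images by (simp add: closed_Un compact_imp_closed)
    have "(path_image c1 \<union> path_image c3) \<inter> (path_image c2 \<union> path_image c3) = path_image c3"
      using meet by blast
    then show "connected ((path_image c1 \<union> path_image c3) \<inter> (path_image c2 \<union> path_image c3))"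
      using arcs by (simp add: connected_path_image arc_imp_path)
    show "connected_component (- (path_image c1 \<union> path_image c3)) z w"
      using conn[of c1 c3 c2] z1 w12 swap theta_curve.rotate[OF swap] by blast
    show "connected_component (- (path_image c2 \<union> path_image c3)) z w"
      using conn[of c2 c3 c1] z2 w12 rotate by blast
  qed
  then have "connected_component (- (path_image c1 \<union> path_image c2)) z w"
    by (rule connected_component_of_subset) blast
  then have "w \<in> inside (path_image c1 \<union> path_image c2)"
    using z inside_same_component by (metis)
  then show False using w12 inside_Int_outside by blast
qed

text \<open>Without its ends the third arc lies in the bounded region of the other two. That region
  is open and misses \<open>outside D\<close>, hence also its closure.\<close>

lemma not_near_outside:
  assumes "path_image c3 \<inter> inside (path_image c1 \<union> path_image c2) \<noteq> {}"
    and "path_image c1 \<union> path_image c2 \<subseteq> D" "v \<in> path_image c3 - {a, b}"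
  shows "v \<notin> closure (outside D)"
proof
  assume v: "v \<in> closure (outside D)"
  have "v \<in> inside (path_image c1 \<union> path_image c2)" using split_inside(2)[OF assms(1)] assms(3) by blast
  moreover have "outside D \<subseteq> outside (path_image c1 \<union> path_image c2)" by (rule outside_mono[OF assms(2)])
  then have "inside (path_image c1 \<union> path_image c2) \<inter> outside D = {}"
    using inside_Int_outside by blast
  ultimately show False
    using v Jordan_union(1) open_Int_closure_eq_empty by (metis disjoint_iff)
qed

text \<open>By \<open>some_inside\<close> one arc enters the region of the other two. An inner point
  near \<open>outside D\<close> rules this out for the first and for the second arc.\<close>

lemma third_inside:
  assumes "path_image c1 \<union> path_image c2 \<union> path_image c3 \<subseteq> D"
    and "v1 \<in> path_image c1 - {a, b}" "v1 \<in> closure (outside D)"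
    and "v2 \<in> path_image c2 - {a, b}" "v2 \<in> closure (outside D)"
  shows "path_image c3 \<inter> inside (path_image c1 \<union> path_image c2) \<noteq> {}"
proof -
  have "path_image c1 \<inter> inside (path_image c2 \<union> path_image c3) = {}"
    using theta_curve.not_near_outside[OF rotate, of D v1] assms by blast
  moreover have "path_image c2 \<inter> inside (path_image c1 \<union> path_image c3) = {}"
    using theta_curve.not_near_outside[OF theta_curve.rotate[OF swap], of D v2] assms by blast
  ultimately show ?thesis using some_inside by blast
qed

end


section \<open>Crossing chords of a closed curve\<close>

lemma end_in_closure_interior:
  fixes g :: "real \<Rightarrow> complex"
  assumes "arc g" "x \<in> path_image g"
  shows "x \<in> closure (path_image g - {pathstart g, pathfinish g})"
proof -
  have "connected (path_image g)" using assms(1) by (simp add: connected_path_image arc_imp_path)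
  moreover have "\<nexists>z. path_image g = {z}"
    using arc_distinct_ends[OF assms(1)] pathstart_in_path_image[of g] pathfinish_in_path_image[of g] by auto
  ultimately have "x islimpt path_image g"
    using assms(2) by (metis connected_imp_perfect)
  then have "x islimpt (path_image g - {pathstart g, pathfinish g}) \<union> {pathstart g, pathfinish g}"
    by (rule islimpt_subset) blast
  then have "x islimpt (path_image g - {pathstart g, pathfinish g})"
    by (simp add: islimpt_insert)
  then show ?thesis by (simp add: closure_def)
qed

text \<open>The arc \<open>e\<close> cuts the bounded region into two halves, and \<open>f\<close>
  without its ends, being connected and disjoint from \<open>e\<close>, stays in one of them. One
  end of \<open>f\<close> is off the boundary of that half, so it lies inside the half, away from
  \<open>outside D\<close>.\<close>

lemma crossing_chords_hide_end:
  assumes T1: "theta_curve c1 c2 e a b" and T2: "theta_curve d1 d2 f v1 v2"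
    and cyc: "path_image c1 \<union> path_image c2 = path_image d1 \<union> path_image d2"
    and ef: "path_image e \<inter> path_image f = {}"
    and D: "path_image c1 \<union> path_image c2 \<union> path_image e \<union> path_image f \<subseteq> D"
    and on: "v1 \<in> path_image c1 - {a, b}" "v2 \<in> path_image c2 - {a, b}"
      "a \<in> path_image d1 - {v1, v2}" "b \<in> path_image d2 - {v1, v2}"
  shows "\<not> {a, b, v1, v2} \<subseteq> closure (outside D)"
proof
  interpret T1: theta_curve c1 c2 e a b by (rule T1)
  interpret T2: theta_curve d1 d2 f v1 v2 by (rule T2)
  assume out: "{a, b, v1, v2} \<subseteq> closure (outside D)"
  let ?I1 = "inside (path_image c1 \<union> path_image e)" and ?I2 = "inside (path_image c2 \<union> path_image e)"
  let ?f = "path_image f - {v1, v2}"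
  have "path_image e \<inter> inside (path_image c1 \<union> path_image c2) \<noteq> {}"
    by (rule T1.third_inside[of D v1 v2]) (use D on out in auto)
  note I = T1.split_inside[OF this]
  have "path_image f \<inter> inside (path_image d1 \<union> path_image d2) \<noteq> {}"
    by (rule T2.third_inside[of D a b]) (use D on out cyc in auto)
  note J = T2.split_inside[OF this]
  have "?f \<subseteq> inside (path_image c1 \<union> path_image c2)" using J(2) cyc by auto
  then have f: "?f \<subseteq> ?I1 \<union> ?I2" using I(2) ef by blast
  interpret U1: theta_curve c1 e c2 a b by (rule theta_curve.swap[OF theta_curve.rotate[OF T1.rotate]])
  interpret U2: theta_curve c2 e c1 a b by (rule T1.rotate)
  have hidden: False if "?f \<subseteq> inside (path_image c \<union> path_image e)" "v \<in> {v1, v2}" "v \<notin> path_image c \<union> path_image e"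
    "theta_curve c e c' a b" "path_image c \<subseteq> D" for c c' v
  proof -
    interpret W: theta_curve c e c' a b by (rule that(4))
    have "v \<in> path_image f" using that(2) T2.meet by auto
    then have "v \<in> closure ?f" using end_in_closure_interior[OF T2.arcs(3)] T2.ends by simp
    then have "v \<in> closure (inside (path_image c \<union> path_image e))"
      using that(1) closure_mono by blast
    then have v: "v \<in> inside (path_image c \<union> path_image e)"
      using that(3) W.Jordan_union(4) by (simp add: closure_Un_frontier)
    have "outside D \<subseteq> outside (path_image c \<union> path_image e)" by (rule outside_mono) (use that D in auto)
    then have "inside (path_image c \<union> path_image e) \<inter> outside D = {}" using inside_Int_outside by blast
    then have "inside (path_image c \<union> path_image e) \<inter> closure (outside D) = {}"
      using W.Jordan_union(1) open_Int_closure_eq_empty by blast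
    then show False using v that(2) out by blast
  qed
  have conn: "connected ?f" using connected_simple_path_endless[of f] T2.arcs(3) T2.ends arc_imp_simple_path by metis
  have "?f \<subseteq> ?I1 \<or> ?f \<subseteq> ?I2"
  proof (rule ccontr)
    assume "\<not> ?thesis"
    then have "?I1 \<inter> ?f \<noteq> {}" "?I2 \<inter> ?f \<noteq> {}" using f by blast+
    then show False
      using connectedD[OF conn U1.Jordan_union(1) U2.Jordan_union(1)] I(1) f by blast
  qed
  moreover have "v2 \<notin> path_image c1 \<union> path_image e" "v1 \<notin> path_image c2 \<union> path_image e"
    using on T1.meet by blast+
  ultimately show False
    using hidden[of c1 v2 c2] hidden[of c2 v1 c1] U1.theta_curve_axioms U2.theta_curve_axioms D by blast
qed

section \<open>Walks in an outerplanar drawing\<close>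

fun walk_edges :: "'a list \<Rightarrow> 'a set set" where
  "walk_edges (x # y # zs) = insert {x, y} (walk_edges (y # zs))"
| "walk_edges _ = {}"

abbreviation walk :: "'a set set \<Rightarrow> 'a list \<Rightarrow> bool" where
  "walk E \<equiv> successively (\<lambda>u v. {u, v} \<in> E)"

lemma walk_edges_subset: "e \<in> walk_edges xs \<Longrightarrow> e \<subseteq> set xs"
  by (induction xs rule: walk_edges.induct) auto

lemma walk_edges_in: "walk E xs \<Longrightarrow> walk_edges xs \<subseteq> E"
  by (induction xs rule: walk_edges.induct) auto

lemma walk_edges_append: "walk_edges (xs @ y # zs) = walk_edges (xs @ [y]) \<union> walk_edges (y # zs)"
  by (induction xs rule: walk_edges.induct) auto

lemma walk_edges_rev: "walk_edges (rev xs) = walk_edges xs"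
proof (induction xs rule: walk_edges.induct)
  case (1 x y zs)
  have "walk_edges (rev (x # y # zs)) = walk_edges (rev (y # zs)) \<union> {{x, y}}"
    using walk_edges_append[of "rev zs" y "[x]"] by (simp add: insert_commute)
  then show ?case using 1 by auto
qed auto

lemma Union_walk_edges: "2 \<le> length xs \<Longrightarrow> \<Union> (walk_edges xs) = set xs"
proof (induction xs rule: walk_edges.induct)
  case (1 x y zs)
  then show ?case by (cases zs) auto
qed auto

text \<open>Keeps a path with inner vertices edge-disjoint from a parallel path that may be the
  single edge \<open>{a, b}\<close>.\<close>

lemma ends_notin_walk_edges:
  assumes "distinct (a # ys @ [b])" "ys \<noteq> []"
  shows "{a, b} \<notin> walk_edges (a # ys @ [b])"
proof
  obtain y ys' where ys: "ys = y # ys'" using assms(2) by (cases ys) auto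
  assume "{a, b} \<in> walk_edges (a # ys @ [b])"
  then have "{a, b} = {a, y} \<or> {a, b} \<in> walk_edges (y # ys' @ [b])" using ys by simp
  then show False
    using walk_edges_subset[of "{a, b}" "y # ys' @ [b]"] assms(1) ys by (auto simp: doubleton_eq_iff)
qed

lemma walk_edges_doubleton: "e \<in> walk_edges xs \<Longrightarrow> distinct xs \<Longrightarrow> \<exists>u v. e = {u, v} \<and> u \<noteq> v"
  by (induction xs rule: walk_edges.induct) auto

lemma walk_append: "walk E (xs @ [y]) \<Longrightarrow> walk E (y # zs) \<Longrightarrow> walk E (xs @ y # zs)"
  by (induction xs rule: walk_edges.induct) auto

lemma walk_split: "walk E (xs @ y # zs) \<longleftrightarrow> walk E (xs @ [y]) \<and> walk E (y # zs)"
  by (induction xs rule: induct_list012) auto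

lemma walk_rev: "walk E (rev xs) \<longleftrightarrow> walk E xs"
  by (simp add: successively_rev insert_commute)

locale outer_drawing =
  fixes V :: "'a set" and E :: "'a set set" and p :: "'a \<Rightarrow> complex" and \<gamma> :: "'a set \<Rightarrow> real \<Rightarrow> complex"
  assumes draw: "planar_drawing V E p \<gamma>"
    and outer: "p ` V \<subseteq> frontier (outside (drawing_points V E p \<gamma>))"
    and edge_subset: "\<And>e. e \<in> E \<Longrightarrow> e \<subseteq> V"
begin

definition im :: "'a set set \<Rightarrow> complex set" where "im F = (\<Union>e\<in>F. path_image (\<gamma> e))"

lemma im_Un: "im (F \<union> G) = im F \<union> im G"
  by (auto simp: im_def)

lemma im_subset: "F \<subseteq> E \<Longrightarrow> im F \<subseteq> drawing_points V E p \<gamma>"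
  by (auto simp: im_def drawing_points_def)

lemma walk_im_subset: "walk E xs \<Longrightarrow> im (walk_edges xs) \<subseteq> drawing_points V E p \<gamma>"
  by (intro im_subset walk_edges_in)

lemma vertex_in_im:
  assumes "e \<in> F" "F \<subseteq> E" "v \<in> e"
  shows "p v \<in> im F"
proof -
  have "e \<in> E" using assms by blast
  then have "path_image (\<gamma> e) \<inter> p ` V = p ` e" using draw by (simp add: planar_drawing_def)
  then show ?thesis using assms by (auto simp: im_def)
qed

lemma im_Int:
  assumes "F \<subseteq> E" "G \<subseteq> E" "F \<inter> G = {}"
  shows "im F \<inter> im G \<subseteq> p ` (\<Union>F \<inter> \<Union>G)"
proof
  fix z assume "z \<in> im F \<inter> im G"
  then obtain e f where ef: "e \<in> F" "f \<in> G" "z \<in> path_image (\<gamma> e)" "z \<in> path_image (\<gamma> f)"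
    by (auto simp: im_def)
  then have "e \<noteq> f" "e \<in> E" "f \<in> E" using assms by auto
  then have "path_image (\<gamma> e) \<inter> path_image (\<gamma> f) = p ` (e \<inter> f)"
    using draw by (auto simp: planar_drawing_def)
  then show "z \<in> p ` (\<Union>F \<inter> \<Union>G)" using ef by blast
qed

lemma edge_arc:
  assumes "{u, v} \<in> E" "u \<noteq> v"
  obtains g where "arc g" "pathstart g = p u" "pathfinish g = p v" "path_image g = path_image (\<gamma> {u, v})"
proof -
  have g: "arc (\<gamma> {u, v})" "{pathstart (\<gamma> {u, v}), pathfinish (\<gamma> {u, v})} = p ` {u, v}"
    using draw assms by (auto simp: planar_drawing_def)
  then have "pathstart (\<gamma> {u, v}) = p u \<and> pathfinish (\<gamma> {u, v}) = p v \<or>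
      pathstart (\<gamma> {u, v}) = p v \<and> pathfinish (\<gamma> {u, v}) = p u"
    by (auto simp: doubleton_eq_iff)
  then show ?thesis
    using g(1) that[of "\<gamma> {u, v}"] that[of "reversepath (\<gamma> {u, v})"] by (auto simp: arc_reversepath)
qed

lemma walk_arc:
  assumes "walk E xs" "distinct xs" "2 \<le> length xs"
  shows "\<exists>g. arc g \<and> pathstart g = p (hd xs) \<and> pathfinish g = p (last xs) \<and> path_image g = im (walk_edges xs)"
  using assms
proof (induction xs rule: walk_edges.induct)
  case (1 x y zs)
  have xy: "{x, y} \<in> E" "x \<noteq> y" using 1 by auto
  obtain g where g: "arc g" "pathstart g = p x" "pathfinish g = p y" "path_image g = path_image (\<gamma> {x, y})"
    by (rule edge_arc[OF xy])
  show ?case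
  proof (cases "zs = []")
    case True
    then show ?thesis using g by (intro exI[of _ g]) (simp add: im_def)
  next
    case False
    then obtain h where h: "arc h" "pathstart h = p y" "pathfinish h = p (last (y # zs))"
      "path_image h = im (walk_edges (y # zs))"
      using 1 by (cases zs) auto
    have "im {{x, y}} \<inter> im (walk_edges (y # zs)) \<subseteq> p ` (\<Union>{{x, y}} \<inter> \<Union>(walk_edges (y # zs)))"
    proof (rule im_Int)
      show "{{x, y}} \<inter> walk_edges (y # zs) = {}"
        using 1(3) walk_edges_subset[of "{x, y}" "y # zs"] by auto
      show "walk_edges (y # zs) \<subseteq> E" using 1(2) by (intro walk_edges_in) simp
    qed (use xy in simp)
    also have "\<dots> \<subseteq> {p y}" using 1(3) walk_edges_subset[of _ "y # zs"] by fastforce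
    finally have "path_image g \<inter> path_image h \<subseteq> {pathstart h}"
      using g h by (simp add: im_def)
    then have "arc (g +++ h)" using g h by (intro arc_join) auto
    moreover have "path_image (g +++ h) = im (walk_edges (x # y # zs))"
      using g h by (simp add: path_image_join im_def)
    ultimately show ?thesis using g h False by (intro exI[of _ "g +++ h"]) simp
  qed
qed auto

lemma walk_vertex_in_im: "walk E xs \<Longrightarrow> 2 \<le> length xs \<Longrightarrow> v \<in> set xs \<Longrightarrow> p v \<in> im (walk_edges xs)"
  using Union_walk_edges[of xs] walk_edges_in[of E xs] vertex_in_im[of _ "walk_edges xs" v] by blast

text \<open>The third list may be empty, so that a single chord can serve as the third arc. Since
  the other two are not empty, no edge is shared by two of the walks, and the arcs meet only in
  common vertices.\<close>

lemma walks_theta: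
  assumes w: "walk E (a # ys1 @ [b])" "walk E (a # ys2 @ [b])" "walk E (a # ys3 @ [b])"
    and d: "distinct (a # b # ys1 @ ys2 @ ys3)" and ne: "ys1 \<noteq> []" "ys2 \<noteq> []"
  obtains c1 c2 c3 where "theta_curve c1 c2 c3 (p a) (p b)" "path_image c1 = im (walk_edges (a # ys1 @ [b]))"
    "path_image c2 = im (walk_edges (a # ys2 @ [b]))" "path_image c3 = im (walk_edges (a # ys3 @ [b]))"
proof -
  let ?W = "\<lambda>ys. walk_edges (a # ys @ [b])"
  have ex: "\<exists>g. arc g \<and> pathstart g = p a \<and> pathfinish g = p b \<and> path_image g = im (?W ys)"
    if "walk E (a # ys @ [b])" "distinct (a # ys @ [b])" for ys
    using walk_arc[OF that] by simp
  have "distinct (a # ys1 @ [b])" "distinct (a # ys2 @ [b])" "distinct (a # ys3 @ [b])" using d by auto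
  with ex w obtain c1 c2 c3 where c:
    "arc c1" "pathstart c1 = p a" "pathfinish c1 = p b" "path_image c1 = im (?W ys1)"
    "arc c2" "pathstart c2 = p a" "pathfinish c2 = p b" "path_image c2 = im (?W ys2)"
    "arc c3" "pathstart c3 = p a" "pathfinish c3 = p b" "path_image c3 = im (?W ys3)"
    by metis
  have meet: "im (?W ys) \<inter> im (?W zs) = {p a, p b}"
    if "walk E (a # ys @ [b])" "walk E (a # zs @ [b])" "distinct (a # b # ys @ zs)" "ys \<noteq> []" for ys zs
  proof
    have W: "?W ys \<subseteq> E" "?W zs \<subseteq> E" using that walk_edges_in by blast+
    have "e \<notin> ?W zs" if "e \<in> ?W ys" for e
    proof
      assume "e \<in> ?W zs"
      then have "e \<subseteq> set (a # ys @ [b]) \<inter> set (a # zs @ [b])" using walk_edges_subset that by blast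
      also have "\<dots> \<subseteq> {a, b}" using \<open>distinct (a # b # ys @ zs)\<close> by auto
      finally have "e \<subseteq> {a, b}" .
      moreover have "\<exists>u v. e = {u, v} \<and> u \<noteq> v"
        by (rule walk_edges_doubleton[OF \<open>e \<in> ?W ys\<close>]) (use \<open>distinct (a # b # ys @ zs)\<close> in auto)
      ultimately have "e = {a, b}" by auto
      moreover have "distinct (a # ys @ [b])" using \<open>distinct (a # b # ys @ zs)\<close> by auto
      ultimately show False using ends_notin_walk_edges[of a ys b] \<open>ys \<noteq> []\<close> that by blast
    qed
    then have "im (?W ys) \<inter> im (?W zs) \<subseteq> p ` (\<Union>(?W ys) \<inter> \<Union>(?W zs))"
      using W by (intro im_Int) auto
    also have "\<dots> \<subseteq> p ` {a, b}"
      using that(3) Union_walk_edges[of "a # ys @ [b]"] Union_walk_edges[of "a # zs @ [b]"] by auto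
    finally show "im (?W ys) \<inter> im (?W zs) \<subseteq> {p a, p b}" by simp
    show "{p a, p b} \<subseteq> im (?W ys) \<inter> im (?W zs)"
      using walk_vertex_in_im[OF that(1)] walk_vertex_in_im[OF that(2)] by simp
  qed
  have "theta_curve c1 c2 c3 (p a) (p b)"
  proof (rule theta_curve.intro)
    show "path_image c1 \<inter> path_image c2 = {p a, p b}"
      unfolding c by (rule meet[OF w(1,2) _ ne(1)]) (use d in auto)
    show "path_image c1 \<inter> path_image c3 = {p a, p b}"
      unfolding c by (rule meet[OF w(1,3) _ ne(1)]) (use d in auto)
    show "path_image c2 \<inter> path_image c3 = {p a, p b}"
      unfolding c by (rule meet[OF w(2,3) _ ne(2)]) (use d in auto)
  qed (fact c)+
  then show ?thesis using c that by blast
qed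

lemma vertex_near_outside: "v \<in> V \<Longrightarrow> p v \<in> closure (outside (drawing_points V E p \<gamma>))"
  using outer by (auto simp: frontier_def)

lemma p_eq_iff: "u \<in> V \<Longrightarrow> v \<in> V \<Longrightarrow> p u = p v \<longleftrightarrow> u = v"
  using draw by (auto simp: planar_drawing_def inj_on_def)

lemma walk_vertex: "walk E xs \<Longrightarrow> 2 \<le> length xs \<Longrightarrow> v \<in> set xs \<Longrightarrow> v \<in> V"
  using Union_walk_edges[of xs] walk_edges_in[of E xs] edge_subset by blast

text \<open>Inner vertices of the first two paths lie on the outer face, so it is the third path
  that runs inside the other two; its own inner vertices are then hidden from the outer
  face.\<close>

lemma no_theta:
  assumes w: "walk E (a # ys1 @ [b])" "walk E (a # ys2 @ [b])" "walk E (a # ys3 @ [b])"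
    and d: "distinct (a # b # ys1 @ ys2 @ ys3)" and ne: "ys1 \<noteq> []" "ys2 \<noteq> []" "ys3 \<noteq> []"
  shows False
proof -
  let ?D = "drawing_points V E p \<gamma>"
  obtain c1 c2 c3 where T: "theta_curve c1 c2 c3 (p a) (p b)" and im: "path_image c1 = im (walk_edges (a # ys1 @ [b]))"
    "path_image c2 = im (walk_edges (a # ys2 @ [b]))" "path_image c3 = im (walk_edges (a # ys3 @ [b]))"
    using walks_theta[OF w d ne(1,2)] by blast
  have sub: "path_image c1 \<subseteq> ?D" "path_image c2 \<subseteq> ?D" "path_image c3 \<subseteq> ?D"
    unfolding im using w by (simp_all add: walk_im_subset)
  have pt: "p (hd ys) \<in> im (walk_edges (a # ys @ [b])) - {p a, p b} \<and> p (hd ys) \<in> closure (outside ?D)"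
    if "walk E (a # ys @ [b])" "ys \<noteq> []" "distinct (a # b # ys)" for ys
  proof -
    have "hd ys \<in> set (a # ys @ [b])" using that(2) by simp
    moreover have "hd ys \<noteq> a" "hd ys \<noteq> b" using that(2,3) hd_in_set[of ys] by auto
    ultimately show ?thesis
      using walk_vertex_in_im[OF that(1)] walk_vertex[OF that(1)] p_eq_iff vertex_near_outside by auto
  qed
  have "path_image c3 \<inter> inside (path_image c1 \<union> path_image c2) \<noteq> {}"
    by (rule theta_curve.third_inside[OF T, of ?D "p (hd ys1)" "p (hd ys2)"])
      (use sub pt[OF w(1)] pt[OF w(2)] d ne im in auto)
  then have "p (hd ys3) \<notin> closure (outside ?D)"
    by (rule theta_curve.not_near_outside[OF T]) (use sub pt[OF w(3)] d ne im in auto)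
  then show False using pt[OF w(3)] d ne by simp
qed

text \<open>The cycle through \<open>a\<close>, \<open>b\<close>, \<open>c\<close>, \<open>d\<close>
  is read as two theta curves, one with the chord from \<open>a\<close> to \<open>c\<close> and one
  with the chord from \<open>b\<close> to \<open>d\<close>.\<close>

lemma no_crossing:
  assumes w: "walk E (a # ys1 @ [b])" "walk E (b # ys2 @ [c])" "walk E (c # ys3 @ [d])" "walk E (d # ys4 @ [a])"
    and dis: "distinct (a # b # c # d # ys1 @ ys2 @ ys3 @ ys4)" and ch: "{a, c} \<in> E" "{b, d} \<in> E"
  shows False
proof -
  let ?D = "drawing_points V E p \<gamma>"
  \<comment> \<open>\<open>?c1\<close> and \<open>?c2\<close> list the inner vertices of the two
    ways around the cycle from \<open>a\<close> to \<open>c\<close>, \<open>?d1\<close> and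
    \<open>?d2\<close> those of the two ways from \<open>b\<close> to \<open>d\<close>.\<close>
  let ?c1 = "ys1 @ b # ys2" and ?c2 = "rev ys4 @ d # rev ys3"
  let ?d1 = "rev ys1 @ a # rev ys4" and ?d2 = "ys2 @ c # ys3"
  have rw: "walk E (b # rev ys1 @ [a])" "walk E (c # rev ys2 @ [b])" "walk E (d # rev ys3 @ [c])" "walk E (a # rev ys4 @ [d])"
    using walk_rev[of E "a # ys1 @ [b]"] walk_rev[of E "b # ys2 @ [c]"] walk_rev[of E "c # ys3 @ [d]"]
      walk_rev[of E "d # ys4 @ [a]"] w by simp_all
  have app: "walk E (x # xs @ y # zs @ [t])" if "walk E (x # xs @ [y])" "walk E (y # zs @ [t])" for x y t xs zs
    using walk_append[of E "x # xs" y "zs @ [t]"] that by simp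
  have W: "walk E (a # ?c1 @ [c])" "walk E (a # ?c2 @ [c])" "walk E (a # [] @ [c])"
    "walk E (b # ?d1 @ [d])" "walk E (b # ?d2 @ [d])" "walk E (b # [] @ [d])"
    using app[OF w(1,2)] app[OF rw(4,3)] app[OF rw(1,4)] app[OF w(2,3)] ch by simp_all
  obtain c1 c2 e where T1: "theta_curve c1 c2 e (p a) (p c)" and im1: "path_image c1 = im (walk_edges (a # ?c1 @ [c]))"
    "path_image c2 = im (walk_edges (a # ?c2 @ [c]))" "path_image e = im (walk_edges (a # [] @ [c]))"
    by (rule walks_theta[OF W(1-3)]) (use dis in auto)
  obtain d1 d2 f where T2: "theta_curve d1 d2 f (p b) (p d)" and im2: "path_image d1 = im (walk_edges (b # ?d1 @ [d]))"
    "path_image d2 = im (walk_edges (b # ?d2 @ [d]))" "path_image f = im (walk_edges (b # [] @ [d]))"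
    by (rule walks_theta[OF W(4-6)]) (use dis in auto)
  have app_edges: "walk_edges (x # xs @ y # zs @ [t]) = walk_edges (x # xs @ [y]) \<union> walk_edges (y # zs @ [t])"
    for x y t :: 'a and xs zs
    using walk_edges_append[of "x # xs" y "zs @ [t]"] by simp
  have rev_edges: "walk_edges (x # rev xs @ [y]) = walk_edges (y # xs @ [x])" for x y :: 'a and xs
    using walk_edges_rev[of "y # xs @ [x]"] by simp
  have cyc: "path_image c1 \<union> path_image c2 = path_image d1 \<union> path_image d2"
    unfolding im1 im2 by (simp add: app_edges rev_edges im_Un[symmetric] Un_ac)
  have "im {{a, c}} \<inter> im {{b, d}} \<subseteq> p ` (\<Union>{{a, c}} \<inter> \<Union>{{b, d}})"
    using ch dis by (intro im_Int) auto
  then have ef: "path_image e \<inter> path_image f = {}" using im1 im2 dis by auto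
  have V: "a \<in> V" "b \<in> V" "c \<in> V" "d \<in> V" using ch edge_subset by auto
  have pts: "p b \<in> path_image c1" "p d \<in> path_image c2" "p a \<in> path_image d1" "p c \<in> path_image d2"
    unfolding im1 im2 using W by (auto intro!: walk_vertex_in_im)
  have "\<not> {p a, p c, p b, p d} \<subseteq> closure (outside ?D)"
  proof (rule crossing_chords_hide_end[OF T1 T2 cyc ef])
    show "path_image c1 \<union> path_image c2 \<union> path_image e \<union> path_image f \<subseteq> ?D"
      unfolding im1 im2 using W by (intro Un_least walk_im_subset)
  qed (use pts V dis p_eq_iff in auto)
  then show False using vertex_near_outside V by auto
qed

end

section \<open>Colouring a polygon with noncrossing chords\<close>

lemma ex_colour_notin:
  fixes A :: "nat set"
  assumes "card (A \<inter> {1..5}) \<le> 4"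
  obtains k where "k \<in> {1..5}" "k \<notin> A"
proof -
  have "\<not> {1..5} \<subseteq> A"
  proof
    assume "{1..5} \<subseteq> A"
    then have "A \<inter> {1..5} = {1..5}" by auto
    then show False using assms by simp
  qed
  then show ?thesis using that by blast
qed

lemma ex_colour_notin_list:
  assumes "length ks \<le> 4"
  obtains k :: nat where "k \<in> {1..5}" "k \<notin> set ks"
proof (rule ex_colour_notin)
  show "card (set ks \<inter> {1..5}) \<le> 4"
    using assms card_length[of ks] card_mono[of "set ks" "set ks \<inter> {1..5}"] by fastforce
qed

text \<open>
  The polygon has vertices \<open>l, \<dots>, r\<close>; \<open>x i\<close> is the colour of the side from \<open>i\<close> to \<open>i + 1\<close>, and \<open>y i\<close> the
  colour of the third edge at \<open>i\<close>, which is the chord from \<open>i\<close> to \<open>m i\<close> if \<open>m i \<noteq> i\<close> and a pendant edge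
  otherwise. \<open>P\<close> and \<open>Q\<close> are the colours of the edges that leave the strip at \<open>l\<close> and at \<open>r\<close>.
\<close>

definition strip_col ::
  "(nat \<Rightarrow> nat) \<Rightarrow> nat \<Rightarrow> nat \<Rightarrow> nat set \<Rightarrow> nat set \<Rightarrow> (nat \<Rightarrow> nat) \<Rightarrow> (nat \<Rightarrow> nat) \<Rightarrow> bool" where
  "strip_col m l r P Q x y \<longleftrightarrow>
     (\<forall>i. l \<le> i \<and> i < r \<longrightarrow> x i \<in> {1..5}) \<and>
     (\<forall>i. l < i \<and> i < r \<longrightarrow> y i \<in> {1..5} \<and> y (m i) = y i) \<and>
     x (l + 1) \<notin> P \<and> y (l + 1) \<notin> P \<and> x (r - 2) \<notin> Q \<and> y (r - 1) \<notin> Q \<and>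
     (\<forall>i. l < i \<and> i + 1 < r \<longrightarrow> {x (i - 1), y i} \<inter> {x (i + 1), y (i + 1)} = {}) \<and>
     (\<forall>i. l < i \<and> i < r \<and> m i \<noteq> i \<longrightarrow>
        {x (i - 1), x i} \<inter> {x (m i - 1), x (m i)} = {})"

text \<open>These are the colours at a chord whose second end is the last inner vertex:
  \<open>p\<close> and \<open>q\<close> belong to the outer sides at its ends, \<open>a\<close> and
  \<open>b\<close> to the sides behind it, \<open>c\<close> to the chord. Chosen blindly, the last
  of the three would have to avoid five values. Each case saves one: \<open>q\<close> already occurs
  among the left or the right prescriptions, or \<open>c = q\<close> is possible.\<close>

lemma chord_to_end_colours_aux:
  fixes p0 p1 p q0 q1 q :: nat
  assumes "p \<in> {1..5}" "q \<in> {1..5}" "p \<noteq> q" "p \<notin> {p0, p1}"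
  shows "\<exists>c a b. {a, b, c} \<subseteq> {1..5} \<and> distinct [a, b, c] \<and>
    c \<notin> {p0, p1, q0, q1} \<and> a \<notin> {p0, p1, q} \<and> b \<notin> {q0, q1, p} \<and> (a \<noteq> p \<or> b \<noteq> q)"
proof (cases "q \<in> {p0, p1}")
  case True
  obtain c where c: "c \<in> {1..5}" "c \<notin> set [p0, p1, q0, q1]"
    by (rule ex_colour_notin_list[of "[p0, p1, q0, q1]"]) auto
  obtain b where b: "b \<in> {1..5}" "b \<notin> set [q0, q1, p, c]"
    by (rule ex_colour_notin_list[of "[q0, q1, p, c]"]) auto
  obtain a where a: "a \<in> {1..5}" "a \<notin> set [p0, p1, c, if b = q then p else b]"
    by (rule ex_colour_notin_list[of "[p0, p1, c, if b = q then p else b]"]) auto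
  show ?thesis
    by (rule exI[of _ c], rule exI[of _ a], rule exI[of _ b]) (use True a b c in \<open>auto split: if_splits\<close>)
next
  case q: False
  show ?thesis
  proof (cases "q \<in> {q0, q1}")
    case True
    obtain c where c: "c \<in> {1..5}" "c \<notin> set [p0, p1, q0, q1]"
      by (rule ex_colour_notin_list[of "[p0, p1, q0, q1]"]) auto
    obtain a where a: "a \<in> {1..5}" "a \<notin> set [p0, p1, q, c]" "c \<noteq> p \<Longrightarrow> a = p"
    proof (cases "c = p")
      case True
      then show ?thesis
        by (rule_tac ex_colour_notin_list[of "[p0, p1, q, c]"]) (auto intro: that)
    qed (use assms in \<open>auto intro: that\<close>)
    obtain b where b: "b \<in> {1..5}" "b \<notin> set [q0, q1, p, if c = p then a else c]"
      by (rule ex_colour_notin_list[of "[q0, q1, p, if c = p then a else c]"]) auto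
    show ?thesis
      by (rule exI[of _ c], rule exI[of _ a], rule exI[of _ b]) (use True a b c in \<open>auto split: if_splits\<close>)
  next
    case False
    obtain b where b: "b \<in> {1..5}" "b \<notin> set [q0, q1, p, q]"
      by (rule ex_colour_notin_list[of "[q0, q1, p, q]"]) auto
    obtain a where a: "a \<in> {1..5}" "a \<notin> set [p0, p1, q, b]"
      by (rule ex_colour_notin_list[of "[p0, p1, q, b]"]) auto
    show ?thesis
      by (rule exI[of _ q], rule exI[of _ a], rule exI[of _ b]) (use False q a b assms in auto)
  qed
qed

text \<open>Reading the strip backwards exchanges the two alternatives of the last
  hypothesis.\<close>

lemma chord_to_end_colours:
  fixes p0 p1 p q0 q1 q :: nat
  assumes "p \<in> {1..5}" "q \<in> {1..5}" "p \<noteq> q" "p \<notin> {p0, p1} \<or> q \<notin> {q0, q1}"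
  shows "\<exists>c a b. {a, b, c} \<subseteq> {1..5} \<and> distinct [a, b, c] \<and>
    c \<notin> {p0, p1, q0, q1} \<and> a \<notin> {p0, p1, q} \<and> b \<notin> {q0, q1, p} \<and> (a \<noteq> p \<or> b \<noteq> q)"
proof (cases "p \<notin> {p0, p1}")
  case True
  from chord_to_end_colours_aux[OF assms(1-3) this] show ?thesis .
next
  case False
  then have "q \<notin> {q0, q1}" using assms(4) by blast
  from chord_to_end_colours_aux[OF assms(2) assms(1) assms(3)[symmetric] this, of p0 p1]
  obtain c a b where "{a, b, c} \<subseteq> {1..5}" "distinct [a, b, c]"
    "c \<notin> {q0, q1, p0, p1}" "a \<notin> {q0, q1, p}" "b \<notin> {p0, p1, q}" "a \<noteq> q \<or> b \<noteq> p" by blast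
  then show ?thesis
    by (intro exI[of _ c] exI[of _ b] exI[of _ a]) auto
qed

section \<open>Assembling colourings of strips\<close>

lemma strip_col_single:
  assumes "x l \<in> {1..5}" "x (l + 1) \<in> {1..5}" "x (l + 1) \<notin> P" "x l \<notin> Q"
    and "c \<in> {1..5}" "c \<notin> P" "c \<notin> Q" "m (l + 1) = l + 1"
  shows "strip_col m l (l + 2) P Q x (\<lambda>_. c)"
  unfolding strip_col_def
proof (intro conjI; (intro allI impI)?)
  show "x i \<in> {1..5}" if "l \<le> i \<and> i < l + 2" for i
  proof -
    have "i = l \<or> i = l + 1" using that by arith
    then show ?thesis using assms(1,2) by blast
  qed
  show "{x (i - 1), x i} \<inter> {x (m i - 1), x (m i)} = {}" if "l < i \<and> i < l + 2 \<and> m i \<noteq> i" for i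
  proof -
    have "i = l + 1" using that by arith
    then show ?thesis using that assms(8) by blast
  qed
qed (use assms in auto)

text \<open>Seen from the shorter strip, the side of colour \<open>p\<close> and the pendant edge of
  colour \<open>c\<close> are what leaves at \<open>l + 1\<close>. So the conditions across the next
  side are already contained in its left prescription \<open>{p, c}\<close>.\<close>

lemma strip_col_cons:
  assumes xy: "strip_col m (l + 1) r {p, c} Q x y" and r: "l + 2 < r" and fixd: "m (l + 1) = l + 1"
    and mi: "\<And>i. l + 1 < i \<Longrightarrow> i < r \<Longrightarrow> l + 1 < m i \<and> m i < r"
    and "p \<in> {1..5}" "c \<in> {1..5}" "x (l + 1) \<notin> P" "c \<notin> P"
  shows "strip_col m l r P Q (x(l := p)) (y(l + 1 := c))" (is "strip_col m l r P Q ?x ?y")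
  unfolding strip_col_def
proof (intro conjI; (intro allI impI)?)
  show "?x i \<in> {1..5}" if "l \<le> i \<and> i < r" for i
    using that xy assms(5) by (auto simp: strip_col_def)
  show "?y i \<in> {1..5} \<and> ?y (m i) = ?y i" if "l < i \<and> i < r" for i
  proof -
    have "i = l + 1 \<or> l + 1 < i \<and> i < r" using that by arith
    then show ?thesis
      using xy fixd assms(6) mi[of i] by (auto simp: strip_col_def)
  qed
  show "{?x (i - 1), ?y i} \<inter> {?x (i + 1), ?y (i + 1)} = {}" if "l < i \<and> i + 1 < r" for i
  proof -
    have "i = l + 1 \<or> l + 1 < i \<and> i + 1 < r" using that by arith
    then show ?thesis
      using xy by (auto simp: strip_col_def)
  qed
  show "{?x (i - 1), ?x i} \<inter> {?x (m i - 1), ?x (m i)} = {}" if i: "l < i \<and> i < r \<and> m i \<noteq> i" for i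
  proof -
    have "i \<noteq> l + 1" using i fixd by blast
    then have i1: "l + 1 < i" "i < r" using i by arith+
    then have "i - 1 \<noteq> l" "m i - 1 \<noteq> l" "i \<noteq> l" "m i \<noteq> l" using mi[of i] by auto
    moreover have "{x (i - 1), x i} \<inter> {x (m i - 1), x (m i)} = {}"
      using xy i i1 unfolding strip_col_def by blast
    ultimately show ?thesis by (simp only: fun_upd_def if_False)
  qed
  show "?x (l + 1) \<notin> P" "?y (l + 1) \<notin> P" using assms by auto
  have "r - 2 \<noteq> l" "r - 1 \<noteq> l + 1" using r by auto
  then show "?x (r - 2) \<notin> Q" "?y (r - 1) \<notin> Q" using xy by (auto simp: strip_col_def)
qed

text \<open>The chord from \<open>l + 1\<close> to \<open>j\<close> splits the strip into the piece
  behind it and the piece beyond \<open>j\<close>. Each piece sees the chord and a side next to it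
  as the edges leaving at its end, hence \<open>{p, c}\<close>, \<open>{c, e}\<close> and
  \<open>{c, b}\<close>. For \<open>j + 1 = r\<close> there is no second piece, and the condition
  imposed by \<open>Q\<close> falls on \<open>c\<close> and \<open>b\<close>.\<close>

lemma strip_col_chord:
  assumes A: "strip_col m (l + 1) j {p, c} {c, e} xa ya" "xa (l + 1) = a" "xa (j - 1) = b"
    and B: "j + 1 = r \<or> strip_col m j r {c, b} Q xb yb" "xb j = e" "j + 1 = r \<Longrightarrow> c \<notin> Q \<and> b \<notin> Q"
    and j: "l + 3 \<le> j" "j < r" and mj: "m (l + 1) = j" "m j = l + 1"
    and inside: "\<And>i. l + 1 < i \<Longrightarrow> i < j \<Longrightarrow> l + 1 < m i \<and> m i < j"
    and beyond: "\<And>i. j < i \<Longrightarrow> i < r \<Longrightarrow> j < m i \<and> m i < r"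
    and "p \<in> {1..5}" "c \<in> {1..5}" "e \<in> {1..5}" "c \<notin> P" "a \<notin> P" and pa: "{p, a} \<inter> {e, b} = {}"
    and xl: "x l = p" and yl: "y (l + 1) = c" "y j = c"
    and xa: "\<And>i. l + 1 \<le> i \<Longrightarrow> i < j \<Longrightarrow> x i = xa i"
    and ya: "\<And>i. l + 1 < i \<Longrightarrow> i < j \<Longrightarrow> y i = ya i"
    and xb: "\<And>i. j \<le> i \<Longrightarrow> x i = xb i" and yb: "\<And>i. j < i \<Longrightarrow> y i = yb i"
  shows "strip_col m l r P Q x y"
proof -
  have r: "j + 1 < r \<Longrightarrow> strip_col m j r {c, b} Q xb yb" using B(1) by simp
  have xj: "x j = e" and xj1: "x (j - 1) = b" and xl1: "x (l + 1) = a"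
    using A(2,3) B(2) j xa[of "j - 1"] xa[of "l + 1"] xb[of j] by auto
  show ?thesis
    unfolding strip_col_def
  proof (intro conjI; (intro allI impI)?)
    show "x i \<in> {1..5}" if i: "l \<le> i \<and> i < r" for i
    proof -
      consider "i = l" | "l + 1 \<le> i" "i < j" | "i = j" | "j \<le> i" "i < r" "j + 1 < r" using \<open>j < r\<close> i by linarith
      then show ?thesis
      proof cases
        case 1 then show ?thesis using xl assms by simp
      next
        case 2 then show ?thesis using xa[of i] A(1) by (simp add: strip_col_def)
      next
        case 3 then show ?thesis using xj assms by simp
      next
        case 4 then show ?thesis using xb[of i] r by (simp add: strip_col_def)
      qed
    qed
    show "y i \<in> {1..5} \<and> y (m i) = y i" if i: "l < i \<and> i < r" for i
    proof -
      consider "i = l + 1" | "l + 1 < i" "i < j" | "i = j" | "j < i" "i < r" "j + 1 < r" using i by linarith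
      then show ?thesis
      proof cases
        case 2 then show ?thesis
          using ya[of i] ya[of "m i"] inside[of i] A(1) by (simp add: strip_col_def)
      next
        case 4 then show ?thesis
          using yb[of i] yb[of "m i"] beyond[of i] r by (simp add: strip_col_def)
      qed (use yl mj assms in simp_all)
    qed
    show "{x (i - 1), y i} \<inter> {x (i + 1), y (i + 1)} = {}" if i: "l < i \<and> i + 1 < r" for i
    proof -
      consider "i = l + 1" | "l + 1 < i" "i + 1 < j" | "i + 1 = j" | "i = j" "j + 1 < r" | "j < i" "j + 1 < r"
        using i by linarith
      then show ?thesis
      proof cases
        case 1
        have "{p, c} \<inter> {xa (l + 2), ya (l + 2)} = {}" using A(1) by (auto simp: strip_col_def)
        then show ?thesis
          using 1 xl yl xa[of "l + 2"] ya[of "l + 2"] j by simp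
      next
        case 2
        then have "{xa (i - 1), ya i} \<inter> {xa (i + 1), ya (i + 1)} = {}"
          using A(1) unfolding strip_col_def by blast
        then show ?thesis using 2 xa[of "i - 1"] ya[of i] xa[of "i + 1"] ya[of "i + 1"] by auto
      next
        case 3
        have "{xa (j - 2), ya (j - 1)} \<inter> {c, e} = {}" using A(1) by (auto simp: strip_col_def)
        moreover have "i - 1 = j - 2" "i = j - 1" using 3 by auto
        ultimately show ?thesis using 3 j xa[of "j - 2"] ya[of "j - 1"] xj yl by simp
      next
        case 4
        have "{c, b} \<inter> {xb (j + 1), yb (j + 1)} = {}" using r[OF 4(2)] by (auto simp: strip_col_def)
        then show ?thesis using 4 xj1 yl xb[of "j + 1"] yb[of "j + 1"] by auto
      next
        case 5
        then have "{xb (i - 1), yb i} \<inter> {xb (i + 1), yb (i + 1)} = {}"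
          using r i unfolding strip_col_def by blast
        then show ?thesis using 5 xb[of "i - 1"] yb[of i] xb[of "i + 1"] yb[of "i + 1"] by auto
      qed
    qed
    show "{x (i - 1), x i} \<inter> {x (m i - 1), x (m i)} = {}" if i: "l < i \<and> i < r \<and> m i \<noteq> i" for i
    proof -
      consider "i = l + 1" | "l + 1 < i" "i < j" | "i = j" | "j < i" "i < r" "j + 1 < r" using i by linarith
      then show ?thesis
      proof cases
        case 1
        then show ?thesis using xl xl1 xj xj1 mj pa by auto
      next
        case 2
        then have "{xa (i - 1), xa i} \<inter> {xa (m i - 1), xa (m i)} = {}"
          using A(1) i unfolding strip_col_def by blast
        moreover have "l + 1 \<le> i - 1" "i - 1 < j" "l + 1 \<le> m i - 1" "m i - 1 < j" "l + 1 \<le> m i" "m i < j"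
          using 2 inside[OF 2] by auto
        ultimately show ?thesis using 2 xa by simp
      next
        case 3
        then show ?thesis using xl xl1 xj xj1 mj pa by auto
      next
        case 4
        then have "{xb (i - 1), xb i} \<inter> {xb (m i - 1), xb (m i)} = {}"
          using r i unfolding strip_col_def by blast
        moreover have "j \<le> i - 1" "j \<le> m i - 1" "j \<le> m i" using 4 beyond[OF 4(1,2)] by auto
        ultimately show ?thesis using 4 xb by simp
      qed
    qed
    show "x (l + 1) \<notin> P" "y (l + 1) \<notin> P" using xl1 yl assms by simp_all
    show "x (r - 2) \<notin> Q" "y (r - 1) \<notin> Q"
    proof -
      have "x (r - 2) \<notin> Q \<and> y (r - 1) \<notin> Q"
      proof (cases "j + 1 = r")
        case True
        then have "r - 2 = j - 1" "r - 1 = j" by auto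
        then show ?thesis using xj1 yl B(3)[OF True] by (simp only:) blast
      next
        case False
        then have "j + 1 < r" using j by simp
        moreover from this have "j \<le> r - 2" "j < r - 1" by auto
        ultimately show ?thesis using xb[of "r - 2"] yb[of "r - 1"] r by (simp add: strip_col_def)
      qed
      then show "x (r - 2) \<notin> Q" "y (r - 1) \<notin> Q" by blast+
    qed
  qed
qed

text \<open>\<open>k\<close> counts the inner vertices beyond the chord, which decides what the side
  colour \<open>e\<close> has to satisfy. With none, \<open>e\<close> is the prescribed end
  \<open>q\<close>; with one, both conditions of a strip with a single inner vertex are needed; from
  two on, \<open>e\<close> is chosen to satisfy the left alternative of the general hypothesis. The
  disjunction about \<open>a\<close> and \<open>b\<close> serves the piece behind the chord.\<close>

lemma chord_colours:
  fixes p0 p1 p q0 q1 q :: nat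
  assumes pq: "p \<in> {1..5}" "q \<in> {1..5}" "p \<noteq> q" "p \<notin> {p0, p1} \<or> q \<notin> {q0, q1}"
  shows "\<exists>c a b e. {a, b, c, e} \<subseteq> {1..5} \<and> c \<notin> {p0, p1} \<and> a \<notin> {p0, p1} \<and>
    {p, a} \<inter> {e, b} = {} \<and> c \<noteq> a \<and> c \<noteq> b \<and> (a \<noteq> p \<or> b \<noteq> e) \<and>
    (k = 0 \<longrightarrow> e = q \<and> c \<notin> {q0, q1} \<and> b \<notin> {q0, q1}) \<and>
    (k = 1 \<longrightarrow> q \<notin> {c, b} \<and> e \<notin> {q0, q1}) \<and>
    (k \<ge> (2::nat) \<longrightarrow> e \<noteq> q \<and> e \<notin> {c, b})"
proof -
  consider "k = 0" | "k = 1" | "k \<ge> 2" by linarith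
  then show ?thesis
  proof cases
    case 1
    from chord_to_end_colours[OF pq] obtain c a b where "{a, b, c} \<subseteq> {1..5}" "distinct [a, b, c]"
      "c \<notin> {p0, p1, q0, q1}" "a \<notin> {p0, p1, q}" "b \<notin> {q0, q1, p}" "a \<noteq> p \<or> b \<noteq> q" by blast
    then show ?thesis using 1 pq
      by - (rule exI[where x = c], rule exI[where x = a], rule exI[where x = b], rule exI[where x = q], auto)
  next
    case 2
    obtain e where e: "e \<in> {1..5}" "e \<notin> set [q0, q1, p, q]"
      by (rule ex_colour_notin_list[of "[q0, q1, p, q]"]) auto
    obtain c where c: "c \<in> {1..5}" "c \<notin> set [p0, p1, q]"
      by (rule ex_colour_notin_list[of "[p0, p1, q]"]) auto
    obtain a where a: "a \<in> {1..5}" "a \<notin> set [p0, p1, e, c]"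
      by (rule ex_colour_notin_list[of "[p0, p1, e, c]"]) auto
    obtain b where b: "b \<in> {1..5}" "b \<notin> set [p, c, q, if a = p then e else a]"
      by (rule ex_colour_notin_list[of "[p, c, q, if a = p then e else a]"]) auto
    show ?thesis using 2 a b c e
      by - (rule exI[where x = c], rule exI[where x = a], rule exI[where x = b], rule exI[where x = e],
        auto split: if_splits)
  next
    case 3
    obtain c where c: "c \<in> {1..5}" "c \<notin> set [p0, p1]"
      by (rule ex_colour_notin_list[of "[p0, p1]"]) auto
    obtain a where a: "a \<in> {1..5}" "a \<notin> set [p0, p1, c]"
      by (rule ex_colour_notin_list[of "[p0, p1, c]"]) auto
    obtain e where e: "e \<in> {1..5}" "e \<notin> set [p, q, c, a]"
      by (rule ex_colour_notin_list[of "[p, q, c, a]"]) auto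
    obtain b where b: "b \<in> {1..5}" "b \<notin> set [p, a, c, e]"
      by (rule ex_colour_notin_list[of "[p, a, c, e]"]) auto
    show ?thesis using 3 a b c e
      by - (rule exI[where x = c], rule exI[where x = a], rule exI[where x = b], rule exI[where x = e], auto)
  qed
qed

text \<open>
  The hypothesis on strips with several inner vertices is chosen so that it reproduces itself when the
  first vertex, or the piece behind the first chord, is cut off.
\<close>

lemma strip_colouring:
  assumes inv: "\<And>i. m (m i) = i" and nonadj: "\<And>i. m i \<noteq> i + 1"
    and nc: "\<And>i j. i < j \<Longrightarrow> j < m i \<Longrightarrow> i < m j \<and> m j < m i"
    and "l + 1 < r" "\<And>i. l < i \<Longrightarrow> i < r \<Longrightarrow> l < m i \<and> m i < r"
    and "p \<in> {1..5}" "q \<in> {1..5}"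
    and "r = l + 2 \<Longrightarrow> q \<notin> {p0, p1} \<and> p \<notin> {q0, q1}"
    and "r \<noteq> l + 2 \<Longrightarrow> p \<noteq> q \<and> (p \<notin> {p0, p1} \<or> q \<notin> {q0, q1})"
  shows "\<exists>x y. strip_col m l r {p0, p1} {q0, q1} x y \<and> x l = p \<and> x (r - 1) = q"
  using assms(4-)
proof (induction "r - l" arbitrary: l r p q p0 p1 q0 q1 rule: less_induct)
  case less
  note clo = less.prems(2) and k1 = less.prems(5) and k2 = less.prems(6)
  note pq = \<open>p \<in> {1..5}\<close> \<open>q \<in> {1..5}\<close>
  have mfix: "m (l + 1) = l + 1" if "r = l + 2" using clo[of "l + 1"] that by auto
  show ?case
  proof (cases "m (l + 1) = l + 1")
    case fixd: True
    show ?thesis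
    proof (cases "r = l + 2")
      case True
      obtain c where c: "c \<in> {1..5}" "c \<notin> set [p0, p1, q0, q1]"
        by (rule ex_colour_notin_list[of "[p0, p1, q0, q1]"]) auto
      have "strip_col m l (l + 2) {p0, p1} {q0, q1} ((\<lambda>_. q)(l := p)) (\<lambda>_. c)"
        by (rule strip_col_single) (use True c pq k1 mfix in simp_all)
      then show ?thesis
        using True by - (rule exI[where x = "(\<lambda>_. q)(l := p)"], rule exI[where x = "\<lambda>_. c"], simp)
    next
      case False
      then have r3: "l + 2 < r" using less.prems(1) by simp
      have "p \<noteq> q" using k2 False by blast
      \<comment> \<open>The remaining strip starts with the side colour \<open>z\<close>. If it has
        a single inner vertex, each end colour must avoid the prescription at the opposite end;
        otherwise it is enough that \<open>z\<close> differs from \<open>q\<close> and lies outside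
        \<open>{p, y1}\<close>.\<close>
      have "\<exists>z y1. z \<in> {1..5} \<and> y1 \<in> {1..5} \<and> z \<notin> {p0, p1} \<and> y1 \<notin> {p0, p1} \<and>
        (r = l + 3 \<longrightarrow> q \<notin> {p, y1} \<and> z \<notin> {q0, q1}) \<and> (r \<noteq> l + 3 \<longrightarrow> z \<noteq> q \<and> z \<notin> {p, y1})"
      proof (cases "r = l + 3")
        case True
        obtain z where z: "z \<in> {1..5}" "z \<notin> set [p0, p1, q0, q1]"
          by (rule ex_colour_notin_list[of "[p0, p1, q0, q1]"]) auto
        obtain y1 where y1: "y1 \<in> {1..5}" "y1 \<notin> set [p0, p1, q]"
          by (rule ex_colour_notin_list[of "[p0, p1, q]"]) auto
        show ?thesis
          using True z y1 \<open>p \<noteq> q\<close> by (intro exI[of _ z] exI[of _ y1]) simp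
      next
        case False
        obtain z where z: "z \<in> {1..5}" "z \<notin> set [p0, p1, p, q]"
          by (rule ex_colour_notin_list[of "[p0, p1, p, q]"]) auto
        obtain y1 where y1: "y1 \<in> {1..5}" "y1 \<notin> set [p0, p1, z]"
          by (rule ex_colour_notin_list[of "[p0, p1, z]"]) auto
        show ?thesis
          using False z y1 by (intro exI[of _ z] exI[of _ y1]) simp
      qed
      then obtain z y1 where zy: "z \<in> {1..5}" "y1 \<in> {1..5}" "z \<notin> {p0, p1}" "y1 \<notin> {p0, p1}"
        and z1: "r = l + 3 \<Longrightarrow> q \<notin> {p, y1} \<and> z \<notin> {q0, q1}"
        and z2: "r \<noteq> l + 3 \<Longrightarrow> z \<noteq> q \<and> z \<notin> {p, y1}" by blast
      have mi: "m i \<noteq> l + 1" if "i \<noteq> l + 1" for i using inv[of i] fixd that by auto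
      have gt: "l + 1 < m i \<and> m i < r" if "l + 1 < i" "i < r" for i
      proof -
        have "l < m i" "m i < r" "m i \<noteq> l + 1" using clo[of i] mi[of i] that by simp_all
        then show ?thesis by simp
      qed
      have "\<exists>x y. strip_col m (l + 1) r {p, y1} {q0, q1} x y \<and> x (l + 1) = z \<and> x (r - 1) = q"
      proof (rule less.hyps)
        show "r = l + 1 + 2 \<Longrightarrow> q \<notin> {p, y1} \<and> z \<notin> {q0, q1}" using z1 by simp
        show "r \<noteq> l + 1 + 2 \<Longrightarrow> z \<noteq> q \<and> (z \<notin> {p, y1} \<or> q \<notin> {q0, q1})" using z2 by simp
        show "l + 1 < m i \<and> m i < r" if "l + 1 < i" "i < r" for i using gt that by blast
        show "l + 1 + 1 < r" "r - (l + 1) < r - l" using r3 by simp_all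
      qed (fact zy(1), fact pq(2))
      then obtain x y where xy: "strip_col m (l + 1) r {p, y1} {q0, q1} x y" "x (l + 1) = z" "x (r - 1) = q"
        by blast
      have "strip_col m l r {p0, p1} {q0, q1} (x(l := p)) (y(l + 1 := y1))"
        by (rule strip_col_cons[OF xy(1) r3 fixd gt pq(1)]) (use zy xy(2) in simp_all)
      moreover have "r - 1 \<noteq> l" using r3 by simp
      ultimately show ?thesis using xy(3)
        by - (rule exI[where x = "x(l := p)"], rule exI[where x = "y(l + 1 := y1)"], simp)
    qed
  next
    case chord: False
    define j where "j = m (l + 1)"
    have mj: "m (l + 1) = j" "m j = l + 1" using inv j_def by auto
    have "l < j" "j < r" using clo[of "l + 1"] less.prems(1) mj by simp_all
    moreover have "j \<noteq> l + 1" "j \<noteq> l + 2" using chord nonadj[of "l + 1"] mj by simp_all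
    ultimately have j: "l + 3 \<le> j" "j < r" by simp_all
    have inside: "l + 1 < m i \<and> m i < j" if "l + 1 < i" "i < j" for i
      using nc[of "l + 1" i] that mj by simp
    \<comment> \<open>A chord starting beyond \<open>j\<close> cannot end behind the chord from
      \<open>l + 1\<close> to \<open>j\<close>, because \<open>m\<close> is an involution and maps
      that piece to itself.\<close>
    have beyond: "j < m i \<and> m i < r" if i: "j < i" "i < r" for i
    proof -
      have "l < m i" "m i < r" using clo[of i] i j by simp_all
      moreover have "m i \<noteq> j" "m i \<noteq> l + 1" using inv[of i] mj i j by auto
      moreover have "\<not> (l + 1 < m i \<and> m i < j)" using inside[of "m i"] inv[of i] i by auto
      ultimately show ?thesis by linarith
    qed
    define k where "k = r - j - 1"
    have "p \<noteq> q \<and> (p \<notin> {p0, p1} \<or> q \<notin> {q0, q1})" using k2 j by simp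
    then obtain c a b e where col: "{a, b, c, e} \<subseteq> {1..5}" "c \<notin> {p0, p1}" "a \<notin> {p0, p1}"
      "{p, a} \<inter> {e, b} = {}" "c \<noteq> a" "c \<noteq> b" "a \<noteq> p \<or> b \<noteq> e"
      and k0: "k = 0 \<Longrightarrow> e = q \<and> c \<notin> {q0, q1} \<and> b \<notin> {q0, q1}"
      and k1: "k = 1 \<Longrightarrow> q \<notin> {c, b} \<and> e \<notin> {q0, q1}"
      and k2: "k \<ge> 2 \<Longrightarrow> e \<noteq> q \<and> e \<notin> {c, b}"
      using chord_colours[of p q p0 p1 q0 q1 k] pq by blast
    have "\<exists>x y. strip_col m (l + 1) j {p, c} {c, e} x y \<and> x (l + 1) = a \<and> x (j - 1) = b"
    proof (rule less.hyps)
      show "j = l + 1 + 2 \<Longrightarrow> b \<notin> {p, c} \<and> a \<notin> {c, e}" using col by auto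
      show "j \<noteq> l + 1 + 2 \<Longrightarrow> a \<noteq> b \<and> (a \<notin> {p, c} \<or> b \<notin> {c, e})" using col by auto
      show "a \<in> {1..5}" "b \<in> {1..5}" using col(1) by auto
      show "j - (l + 1) < r - l" "l + 1 + 1 < j" using j by simp_all
      show "l + 1 < m i \<and> m i < j" if "l + 1 < i" "i < j" for i using inside that .
    qed
    then obtain xa ya where A: "strip_col m (l + 1) j {p, c} {c, e} xa ya" "xa (l + 1) = a" "xa (j - 1) = b"
      by blast
    have "\<exists>x y. (j + 1 = r \<or> strip_col m j r {c, b} {q0, q1} x y) \<and> x j = e \<and> x (r - 1) = q"
    proof (cases "j + 1 = r")
      case True
      then have "k = 0" "r - 1 = j" by (simp_all add: k_def)
      then show ?thesis using k0 True by - (rule exI[where x = "\<lambda>_. q"], simp)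
    next
      case False
      have "\<exists>x y. strip_col m j r {c, b} {q0, q1} x y \<and> x j = e \<and> x (r - 1) = q"
      proof (rule less.hyps)
        show "r = j + 2 \<Longrightarrow> q \<notin> {c, b} \<and> e \<notin> {q0, q1}" using k1 by (simp add: k_def)
        show "r \<noteq> j + 2 \<Longrightarrow> e \<noteq> q \<and> (e \<notin> {c, b} \<or> q \<notin> {q0, q1})"
          using k2 False j by (simp add: k_def)
        show "e \<in> {1..5}" "q \<in> {1..5}" using col(1) pq by auto
        show "r - j < r - l" "j + 1 < r" using j False by simp_all
        show "j < m i \<and> m i < r" if "j < i" "i < r" for i using beyond that .
      qed
      then show ?thesis by blast
    qed
    then obtain xb yb where B: "j + 1 = r \<or> strip_col m j r {c, b} {q0, q1} xb yb" "xb j = e" "xb (r - 1) = q"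
      by blast
    define x where "x = (\<lambda>i. if i = l then p else if i < j then xa i else xb i)"
    define y where "y = (\<lambda>i. if i = l + 1 \<or> i = j then c else if i < j then ya i else yb i)"
    have "strip_col m l r {p0, p1} {q0, q1} x y"
    proof (rule strip_col_chord[OF A B(1,2) _ j mj inside beyond])
      show "j + 1 = r \<Longrightarrow> c \<notin> {q0, q1} \<and> b \<notin> {q0, q1}" using k0 by (simp add: k_def)
    qed (use j pq col in \<open>auto simp: x_def y_def\<close>)
    moreover have "x l = p" by (simp add: x_def)
    moreover have "\<not> r - 1 < j" "r - 1 \<noteq> l" using j by linarith+
    then have "x (r - 1) = q" using B(3) by (simp only: x_def if_False)
    ultimately show ?thesis by blast
  qed
qed

text \<open>The polygon is cut open at vertex 0. Without a chord there it becomes a strip from 0 to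
  \<open>n + 1\<close> whose two ends are the same vertex. With a chord at 0, nothing is prescribed,
  and the chord separates two strips that can be given convenient ends.\<close>

lemma cycle_colouring:
  fixes m :: "nat \<Rightarrow> nat" and n d :: nat and S :: "nat set"
  assumes inv: "\<And>i. m (m i) = i" and nonadj: "\<And>i. m i \<noteq> i + 1"
    and nc: "\<And>i j. i < j \<Longrightarrow> j < m i \<Longrightarrow> i < m j \<and> m j < m i"
    and "2 \<le> n" "\<And>i. i \<le> n \<Longrightarrow> m i \<le> n" "m 0 \<noteq> n"
    and root: "m 0 = 0 \<or> d = 0 \<and> S = {}" and S: "card (S \<inter> {1..5}) \<le> 2"
  shows "\<exists>x y. (\<forall>i\<le>n. x i \<in> {1..5} \<and> y i \<in> {1..5} \<and> y (m i) = y i) \<and>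
    (\<forall>i\<le>n. {x (if i = 0 then n else i - 1), y i} \<inter>
        {x (if i = n then 0 else i + 1), y (if i = n then 0 else i + 1)} = {}) \<and>
    (\<forall>i\<le>n. m i \<noteq> i \<longrightarrow> {x (if i = 0 then n else i - 1), x i} \<inter>
        {x (if m i = 0 then n else m i - 1), x (m i)} = {}) \<and>
    x 0 \<notin> S \<and> x n \<notin> S \<and> (d \<in> {1..5} \<longrightarrow> y 0 = d)"
proof (cases "m 0 = 0")
  case True
  \<comment> \<open>A \<open>d\<close> that is no colour imposes nothing, so 1 is an arbitrary
    choice for the third edge at 0.\<close>
  define d' where "d' = (if d \<in> {1..5} then d else 1)"
  have d': "d' \<in> {1..5}" by (simp add: d'_def)
  obtain g where g: "g \<in> {1..5}" "g \<notin> S" using ex_colour_notin[of S] S by auto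
  have "card (insert g S \<inter> {1..5}) \<le> card (insert g (S \<inter> {1..5}))" by (rule card_mono) auto
  also have "\<dots> \<le> 4" using S card_insert_le_m1[of 4 "S \<inter> {1..5}" g] by simp
  finally obtain h where h: "h \<in> {1..5}" "h \<notin> insert g S" by (rule ex_colour_notin)
  \<comment> \<open>At each end of the strip, the third edge at 0 and the side at the other end
    leave. As \<open>g\<close> and \<open>h\<close> differ, at least one of them is not
    \<open>d'\<close>, which is the alternative that \<open>strip_colouring\<close> asks
    for.\<close>
  have "\<exists>x y. strip_col m 0 (n + 1) {d', h} {d', g} x y \<and> x 0 = g \<and> x (n + 1 - 1) = h"
  proof (rule strip_colouring[of m, OF inv nonadj nc])
    show "0 < m i \<and> m i < n + 1" if "0 < i" "i < n + 1" for i
    proof -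
      have "m i \<noteq> 0" using inv[of i] True that by (cases "m i") auto
      then show ?thesis using assms(5)[of i] that by simp
    qed
  qed (use \<open>2 \<le> n\<close> g h in auto)
  then obtain x y where xy: "strip_col m 0 (n + 1) {d', h} {d', g} x y" and x: "x 0 = g" "x n = h" by auto
  let ?y = "y(0 := d')"
  have mi: "0 < m i" if "0 < i" for i using inv[of i] True that by (cases "m i") auto
  show ?thesis
  proof (rule exI[of _ x], rule exI[of _ ?y], intro conjI allI impI)
    fix i assume i: "i \<le> n"
    show "x i \<in> {1..5}" using xy i by (simp add: strip_col_def)
    show "?y i \<in> {1..5}" using xy i d' by (cases "i = 0") (simp_all add: strip_col_def)
    show "?y (m i) = ?y i" using xy i True mi[of i] by (cases "i = 0") (simp_all add: strip_col_def)
    show "{x (if i = 0 then n else i - 1), ?y i} \<inter>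
        {x (if i = n then 0 else i + 1), ?y (if i = n then 0 else i + 1)} = {}"
    proof -
      consider "i = 0" | "0 < i" "i + 1 < n + 1" | "i = n" using i by linarith
      then show ?thesis
      proof cases
        case 1
        then show ?thesis using xy x \<open>2 \<le> n\<close> by (auto simp: strip_col_def)
      next
        case 2
        then have "{x (i - 1), y i} \<inter> {x (i + 1), y (i + 1)} = {}"
          using xy unfolding strip_col_def by blast
        then show ?thesis using 2 by simp
      next
        case 3
        then show ?thesis using xy x \<open>2 \<le> n\<close> by (auto simp: strip_col_def)
      qed
    qed
    assume "m i \<noteq> i"
    then have "0 < i" using True by (cases i) auto
    moreover have "{x (i - 1), x i} \<inter> {x (m i - 1), x (m i)} = {}"
      using xy i \<open>m i \<noteq> i\<close> \<open>0 < i\<close> unfolding strip_col_def by (metis le_imp_less_Suc Suc_eq_plus1)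
    ultimately show "{x (if i = 0 then n else i - 1), x i} \<inter>
        {x (if m i = 0 then n else m i - 1), x (m i)} = {}" using mi[of i] by simp
  qed (use x g h in \<open>auto simp: d'_def\<close>)
next
  case False
  then have dS: "d = 0" "S = {}" using root by auto
  define j where "j = m 0"
  have mj: "m 0 = j" "m j = 0" using inv j_def by auto
  have j: "2 \<le> j" "j + 1 \<le> n" "j \<noteq> 1"
    using False nonadj[of 0] assms(5)[of 0] \<open>m 0 \<noteq> n\<close> mj by simp_all
  have inside: "0 < m i \<and> m i < j" if "0 < i" "i < j" for i
    using nc[of 0 i] that mj by simp
  have beyond: "j < m i \<and> m i < n + 1" if i: "j < i" "i < n + 1" for i
  proof -
    have "m i < n + 1" using assms(5)[of i] i by simp
    moreover have "m i \<noteq> j" "m i \<noteq> 0" using inv[of i] mj i by (metis not_less0, metis less_irrefl)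
    moreover have "\<not> (0 < m i \<and> m i < j)" using inside[of "m i"] inv[of i] i by auto
    ultimately show ?thesis by linarith
  qed
  \<comment> \<open>The chord gets 3 and the four sides at its ends get 1, 2, 4, 5. As these are all
    different, the hypotheses on both strips hold, whatever their lengths.\<close>
  have "\<exists>x y. strip_col m 0 j {3, 5} {3, 4} x y \<and> x 0 = 1 \<and> x (j - 1) = 2"
    by (rule strip_colouring[of m, OF inv nonadj nc _ inside]) (use j in auto)
  then obtain xa ya where A: "strip_col m 0 j {3, 5} {3, 4} xa ya" "xa 0 = 1" "xa (j - 1) = 2" by blast
  have "\<exists>x y. strip_col m j (n + 1) {3, 2} {3, 1} x y \<and> x j = 4 \<and> x (n + 1 - 1) = 5"
    by (rule strip_colouring[of m, OF inv nonadj nc _ beyond]) (use j in auto)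
  then obtain xb yb where B: "strip_col m j (n + 1) {3, 2} {3, 1} xb yb" "xb j = 4" "xb n = 5" by auto
  obtain x y :: "nat \<Rightarrow> nat" where xa: "\<And>i. i < j \<Longrightarrow> x i = xa i" and xb: "\<And>i. j \<le> i \<Longrightarrow> x i = xb i"
    and ya: "\<And>i. 0 < i \<Longrightarrow> i < j \<Longrightarrow> y i = ya i" and yb: "\<And>i. j < i \<Longrightarrow> y i = yb i"
    and y0: "y 0 = 3" "y j = 3"
    using that[of "\<lambda>i. if i < j then xa i else xb i"
      "\<lambda>i. if i = 0 \<or> i = j then 3 else if i < j then ya i else yb i"] j by force
  have x: "x 0 = 1" "x (j - 1) = 2" "x j = 4" "x n = 5"
    using A B j xa[of 0] xa[of "j - 1"] xb[of j] xb[of n] by auto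
  show ?thesis
  proof (rule exI[of _ x], rule exI[of _ y], intro conjI allI impI)
    fix i assume i: "i \<le> n"
    then consider "i = 0" | "0 < i" "i < j" | "i = j" | "j < i" "i < n + 1" by linarith
    note cases = this
    show "x i \<in> {1..5}"
      using cases by cases (use A B x xa[of i] xb[of i] in \<open>auto simp: strip_col_def\<close>)
    show "y i \<in> {1..5}"
      using cases by cases (use A B y0 ya[of i] yb[of i] in \<open>auto simp: strip_col_def\<close>)
    show "y (m i) = y i"
      using cases
    proof cases
      case 2 then show ?thesis using ya[of i] ya[of "m i"] inside[of i] A by (simp add: strip_col_def)
    next
      case 4 then show ?thesis using yb[of i] yb[of "m i"] beyond[of i] B by (simp add: strip_col_def)
    qed (use mj y0 in simp_all)
    show "{x (if i = 0 then n else i - 1), y i} \<inter>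
        {x (if i = n then 0 else i + 1), y (if i = n then 0 else i + 1)} = {}"
    proof -
      consider "i = 0" | "0 < i" "i + 1 < j" | "i + 1 = j" "0 < i" | "i = j" | "j < i" "i + 1 < n + 1" | "i = n"
        using i by linarith
      then show ?thesis
      proof cases
        case 1
        have "{5, 3} \<inter> {xa 1, ya 1} = {}" using A by (auto simp: strip_col_def)
        then show ?thesis using 1 x y0 xa[of 1] ya[of 1] j by simp
      next
        case 2
        then have "{xa (i - 1), ya i} \<inter> {xa (i + 1), ya (i + 1)} = {}"
          using A(1) unfolding strip_col_def by blast
        moreover have "i \<noteq> 0" "i \<noteq> n" using 2 j by simp_all
        ultimately show ?thesis using 2 xa[of "i - 1"] ya[of i] xa[of "i + 1"] ya[of "i + 1"] by simp
      next
        case 3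
        have "{xa (j - 2), ya (j - 1)} \<inter> {3, 4} = {}" using A(1) by (auto simp: strip_col_def)
        moreover have "i - 1 = j - 2" "i = j - 1" "i \<noteq> n" "i + 1 = j" using 3 j by auto
        moreover have "x (j - 2) = xa (j - 2)" "y (j - 1) = ya (j - 1)" using 3 j xa ya by auto
        ultimately show ?thesis using 3 x y0 by (simp only: if_False) simp
      next
        case 4
        have "{2, 3} \<inter> {xb (j + 1), yb (j + 1)} = {}" using B(1) by (auto simp: strip_col_def)
        then show ?thesis using 4 j x y0 xb[of "j + 1"] yb[of "j + 1"] by simp
      next
        case 5
        then have "{xb (i - 1), yb i} \<inter> {xb (i + 1), yb (i + 1)} = {}"
          using B(1) unfolding strip_col_def by blast
        then show ?thesis using 5 xb[of "i - 1"] yb[of i] xb[of "i + 1"] yb[of "i + 1"] by simp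
      next
        case 6
        have "{xb (n - 1), yb n} \<inter> {1, 3} = {}" using B(1) by (auto simp: strip_col_def)
        then show ?thesis using 6 j x y0 xb[of "n - 1"] yb[of n] by simp
      qed
    qed
    assume mi: "m i \<noteq> i"
    show "{x (if i = 0 then n else i - 1), x i} \<inter> {x (if m i = 0 then n else m i - 1), x (m i)} = {}"
      using cases
    proof cases
      case 2
      then have "{xa (i - 1), xa i} \<inter> {xa (m i - 1), xa (m i)} = {}"
        using A(1) mi unfolding strip_col_def by blast
      moreover have "i - 1 < j" "m i - 1 < j" "m i < j" "m i \<noteq> 0" using 2 inside[OF 2] by auto
      ultimately show ?thesis using 2 xa by simp
    next
      case 4
      then have "{xb (i - 1), xb i} \<inter> {xb (m i - 1), xb (m i)} = {}"
        using B(1) mi unfolding strip_col_def by blast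
      moreover have "j \<le> i - 1" "j \<le> m i - 1" "j \<le> m i" "m i \<noteq> 0" using 4 beyond[OF 4(1,2)] by auto
      ultimately show ?thesis using 4 xb by simp
    qed (use mj x j in simp_all)
  qed (use dS in auto)
qed

section \<open>Cycles and ears\<close>

definition nbs :: "'a set set \<Rightarrow> 'a \<Rightarrow> 'a set" where
  "nbs E v = {u. {v, u} \<in> E}"

text \<open>No subdivision of K(2,3): one of the three parallel paths has to be a single
  edge.\<close>

definition theta_free :: "'a set set \<Rightarrow> bool" where
  "theta_free E \<longleftrightarrow> (\<forall>a b ys1 ys2 ys3. walk E (a # ys1 @ [b]) \<longrightarrow> walk E (a # ys2 @ [b]) \<longrightarrow>
     walk E (a # ys3 @ [b]) \<longrightarrow> distinct (a # b # ys1 @ ys2 @ ys3) \<longrightarrow>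
     ys1 = [] \<or> ys2 = [] \<or> ys3 = [])"

text \<open>No cycle with two crossing chords, that is, no subdivision of K4 in which two opposite
  edges stay undivided.\<close>

definition crossing_free :: "'a set set \<Rightarrow> bool" where
  "crossing_free E \<longleftrightarrow> (\<forall>a b c d ys1 ys2 ys3 ys4. walk E (a # ys1 @ [b]) \<longrightarrow> walk E (b # ys2 @ [c]) \<longrightarrow>
     walk E (c # ys3 @ [d]) \<longrightarrow> walk E (d # ys4 @ [a]) \<longrightarrow>
     distinct (a # b # c # d # ys1 @ ys2 @ ys3 @ ys4) \<longrightarrow> {a, c} \<notin> E \<or> {b, d} \<notin> E)"

lemma theta_freeD:
  "theta_free E \<Longrightarrow> walk E (a # ys1 @ [b]) \<Longrightarrow> walk E (a # ys2 @ [b]) \<Longrightarrow> walk E (a # ys3 @ [b]) \<Longrightarrow>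
    distinct (a # b # ys1 @ ys2 @ ys3) \<Longrightarrow> ys1 = [] \<or> ys2 = [] \<or> ys3 = []"
  unfolding theta_free_def by blast

text \<open>Every clause passes to subsets of the edges, so the induction need not restrict
  drawings. No vertex set is kept; elements of the type without edges simply have no
  neighbours.\<close>

definition subcubic_outer :: "'a set set \<Rightarrow> bool" where
  "subcubic_outer E \<longleftrightarrow> finite E \<and> (\<forall>e\<in>E. card e = 2) \<and> (\<forall>v. card (nbs E v) \<le> 3) \<and>
     theta_free E \<and> crossing_free E"

lemma walk_mono: "walk F xs \<Longrightarrow> F \<subseteq> E \<Longrightarrow> walk E xs"
  by (erule successively_mono) auto

lemma finite_nbs:
  assumes "finite E" "\<forall>e\<in>E. card e = 2"
  shows "finite (nbs E v)"
proof -
  have "finite (\<Union>E)" using assms by (metis card.infinite finite_Union zero_neq_numeral)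
  moreover have "nbs E v \<subseteq> \<Union>E" by (auto simp: nbs_def)
  ultimately show ?thesis by (rule finite_subset[rotated])
qed

lemma subcubic_outer_subset:
  assumes "subcubic_outer E" "F \<subseteq> E"
  shows "subcubic_outer F"
proof -
  have "card (nbs F v) \<le> card (nbs E v)" for v
    using assms by (intro card_mono finite_nbs) (auto simp: subcubic_outer_def nbs_def)
  then have "card (nbs F v) \<le> 3" for v using assms(1) by (meson order_trans subcubic_outer_def)
  moreover have "theta_free F"
    using assms walk_mono[OF _ assms(2)] unfolding subcubic_outer_def theta_free_def by metis
  moreover have "crossing_free F"
    using assms walk_mono[OF _ assms(2)] unfolding subcubic_outer_def crossing_free_def by blast
  ultimately show ?thesis using assms finite_subset by (auto simp: subcubic_outer_def)
qed

section \<open>Reachability along edges\<close>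

definition reach :: "'a set set \<Rightarrow> 'a \<Rightarrow> 'a set" where
  "reach F z = {v. (z, v) \<in> {(u, v). {u, v} \<in> F}\<^sup>*}"

lemma reach_refl: "z \<in> reach F z"
  by (simp add: reach_def)

lemma reach_step: "u \<in> reach F z \<Longrightarrow> {u, v} \<in> F \<Longrightarrow> v \<in> reach F z"
  unfolding reach_def by (auto intro: rtrancl_into_rtrancl)

lemma reach_walk:
  assumes "v \<in> reach F z"
  shows "\<exists>ws. walk F ws \<and> distinct ws \<and> ws \<noteq> [] \<and> hd ws = z \<and> last ws = v"
  using assms unfolding reach_def mem_Collect_eq
proof (induction rule: rtrancl_induct)
  case base
  then show ?case by (intro exI[of _ "[z]"]) simp
next
  case (step u v)
  then obtain ws where ws: "walk F ws" "distinct ws" "ws \<noteq> []" "hd ws = z" "last ws = u" by blast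
  show ?case
  proof (cases "v \<in> set ws")
    case True
    then obtain as bs where "ws = as @ v # bs" by (meson split_list)
    then show ?thesis using ws
      by (intro exI[of _ "as @ [v]"]) (auto simp: successively_append_iff hd_append split: if_splits)
  next
    case False
    then show ?thesis using ws step(2)
      by (intro exI[of _ "ws @ [v]"]) (auto simp: successively_append_iff)
  qed
qed

lemma reach_first_hit:
  assumes "reach F z \<inter> X \<noteq> {}" "z \<notin> X"
  obtains ws w where "walk F (z # ws @ [w])" "distinct (z # ws)" "w \<in> X" "set (z # ws) \<inter> X = {}"
proof -
  obtain v where v: "v \<in> reach F z" "v \<in> X" using assms by blast
  then obtain ws where ws: "walk F ws" "distinct ws" "ws \<noteq> []" "hd ws = z" "last ws = v"
    using reach_walk by metis
  then have "\<exists>w\<in>set ws. w \<in> X" using v last_in_set by metis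
  then obtain as w bs where s: "ws = as @ w # bs" "w \<in> X" "\<forall>u\<in>set as. u \<notin> X"
    using split_list_first_prop[of ws "\<lambda>w. w \<in> X"] by blast
  have "as \<noteq> []" using s ws assms(2) by auto
  then obtain cs where as: "as = z # cs" using ws s by (cases as) auto
  have "walk F (as @ [w])" using ws(1) s(1) by (auto simp: successively_append_iff)
  then show ?thesis using that[of cs w] as s ws(2) by auto
qed

definition cyc :: "'a set set \<Rightarrow> 'a list \<Rightarrow> bool" where
  "cyc E xs \<longleftrightarrow> 3 \<le> length xs \<and> distinct xs \<and> walk E xs \<and> {last xs, hd xs} \<in> E"

text \<open>If \<open>u\<close> and \<open>v\<close> are neighbours on the cycle, possibly across
  the closing edge, the ear replaces the edge between them. Otherwise the ear and both ways around
  the cycle have inner vertices, against \<open>theta_free\<close>. The head is preserved because it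
  will be the root.\<close>

lemma cyc_ear:
  assumes cyc: "cyc E xs" and xs: "xs = as @ u # bs @ v # cs" and "theta_free E"
    and ear: "walk E (u # ws @ [v])" "distinct ws" "ws \<noteq> []" "set ws \<inter> set xs = {}"
  shows "\<exists>xs'. cyc E xs' \<and> hd xs' = hd xs \<and> length xs < length xs'"
proof -
  have w: "walk E (as @ u # bs @ v # cs)" and dis: "distinct (as @ u # bs @ v # cs)"
    and close: "{last (v # cs), hd (as @ [u])} \<in> E"
    using cyc unfolding cyc_def xs by (auto simp: hd_append)
  have wu: "walk E (as @ [u])" and wb: "walk E (u # bs @ [v])" and wc: "walk E (v # cs)"
    using w walk_split[of E as u "bs @ v # cs"] walk_split[of E "u # bs" v cs] by simp_all
  consider "bs = []" | "as = []" "cs = []" | "bs \<noteq> []" "as @ cs \<noteq> []" by auto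
  then show ?thesis
  proof cases
    case 1
    have "walk E (as @ u # ws @ v # cs)"
      using walk_append[OF wu walk_append[of E "u # ws" v cs, simplified]] ear(1) wc by simp
    moreover have "distinct (as @ u # ws @ v # cs)" using dis ear xs by auto
    moreover have len: "length xs < length (as @ u # ws @ v # cs)" using ear(3) xs 1 by simp
    moreover have hd: "hd (as @ u # ws @ v # cs) = hd (as @ [u])" by (simp add: hd_append)
    moreover have "last (as @ u # ws @ v # cs) = last (v # cs)" by simp
    moreover have "3 \<le> length (as @ u # ws @ v # cs)" using cyc len unfolding cyc_def by linarith
    ultimately have "cyc E (as @ u # ws @ v # cs)" using close unfolding cyc_def by (simp only:)
    moreover have "hd xs = hd (as @ [u])" by (simp add: xs hd_append)
    ultimately show ?thesis using len hd by (intro exI[of _ "as @ u # ws @ v # cs"]) simp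
  next
    case 2
    let ?ys = "u # bs @ v # rev ws"
    have "walk E (v # rev ws @ [u])" using walk_rev[of E "u # ws @ [v]"] ear(1) by simp
    then have vw: "walk E (v # rev ws)" "{last (rev ws), u} \<in> E"
      using ear(3) successively_append_iff[of "\<lambda>u v. {u, v} \<in> E" "v # rev ws" "[u]"] by simp_all
    have "walk E ?ys" using walk_append[of E "u # bs" v "rev ws"] wb vw(1) by simp
    moreover have "distinct ?ys" using dis ear xs 2 by auto
    moreover have "last ?ys = last (rev ws)" using ear(3) by simp
    moreover have "length xs < length ?ys" using ear(3) xs 2 by simp
    ultimately have "cyc E ?ys" using vw(2) cyc unfolding cyc_def by simp
    then show ?thesis using \<open>length xs < length ?ys\<close> xs 2 by (intro exI[of _ ?ys]) simp
  next
    case 3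
    \<comment> \<open>The other way around the cycle: from \<open>u\<close> back to the head, over
      the closing edge, and from the last vertex back to \<open>v\<close>.\<close>
    have walk_back: "walk E (u # (rev as @ rev cs) @ [v])"
    proof -
      have "walk E (u # rev as)" "walk E (rev cs @ [v])"
        using walk_rev[of E "as @ [u]"] walk_rev[of E "v # cs"] wu wc by simp_all
      moreover have "{last (u # rev as), hd (rev cs @ [v])} \<in> E"
        using close by (cases as; cases cs rule: rev_cases) (auto simp: insert_commute)
      ultimately have "walk E ((u # rev as) @ (rev cs @ [v]))"
        unfolding successively_append_iff by simp
      then show ?thesis by simp
    qed
    have "distinct (u # v # bs @ (rev as @ rev cs) @ ws)" using dis ear xs by auto
    from theta_freeD[OF \<open>theta_free E\<close> wb walk_back ear(1) this]
    show ?thesis using ear(3) 3 by simp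
  qed
qed

lemma cyc_ear_ends:
  assumes cyc: "cyc E xs" and uv: "u \<in> set xs" "v \<in> set xs" "u \<noteq> v" and "theta_free E"
    and ear: "walk E (u # ws @ [v])" "distinct ws" "ws \<noteq> []" "set ws \<inter> set xs = {}"
  shows "\<exists>xs'. cyc E xs' \<and> hd xs' = hd xs \<and> length xs < length xs'"
proof -
  obtain as bs where s: "xs = as @ u # bs" using uv(1) by (meson split_list)
  then consider "v \<in> set as" | "v \<in> set bs" using uv by auto
  then show ?thesis
  proof cases
    case 1
    then obtain cs ds where "as = cs @ v # ds" by (meson split_list)
    then have "xs = cs @ v # ds @ u # bs" using s by simp
    moreover have "walk E (v # rev ws @ [u])" using walk_rev[of E "u # ws @ [v]"] ear(1) by simp
    ultimately show ?thesis using cyc_ear[OF cyc _ \<open>theta_free E\<close>, of cs v ds u bs "rev ws"] ear by simp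
  next
    case 2
    then obtain cs ds where "bs = cs @ v # ds" by (meson split_list)
    then have "xs = as @ u # cs @ v # ds" using s by simp
    then show ?thesis using cyc_ear[OF cyc _ \<open>theta_free E\<close>, of as u cs v ds ws] ear by simp
  qed
qed

lemma cyc_crossing:
  assumes cyc: "cyc E xs" and "crossing_free E" and ijkl: "i < j" "j < k" "k < l" "l < length xs"
    and ch: "{xs ! i, xs ! k} \<in> E" "{xs ! j, xs ! l} \<in> E"
  shows False
proof -
  define as where "as = take i xs"
  define bs where "bs = take (j - i - 1) (drop (i + 1) xs)"
  define cs where "cs = take (k - j - 1) (drop (j + 1) xs)"
  define ds where "ds = take (l - k - 1) (drop (k + 1) xs)"
  define fs where "fs = drop (l + 1) xs"
  have dr: "drop (a + 1) xs = take (b - a - 1) (drop (a + 1) xs) @ xs ! b # drop (b + 1) xs" if "a < b" "b < length xs" for a b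
  proof -
    have "b - a - 1 + (a + 1) = b" using that by simp
    then have "drop (b - a - 1) (drop (a + 1) xs) = drop b xs" by (simp only: drop_drop)
    also have "\<dots> = xs ! b # drop (b + 1) xs" using that by (simp add: Cons_nth_drop_Suc)
    finally show ?thesis using append_take_drop_id[of "b - a - 1" "drop (a + 1) xs"] by simp
  qed
  have "xs = as @ xs ! i # drop (i + 1) xs" using ijkl by (simp add: as_def id_take_nth_drop[symmetric])
  then have xs: "xs = as @ xs ! i # bs @ xs ! j # cs @ xs ! k # ds @ xs ! l # fs"
    using dr[of i j] dr[of j k] dr[of k l] ijkl unfolding bs_def cs_def ds_def fs_def by simp
  let ?a = "xs ! i" and ?b = "xs ! j" and ?c = "xs ! k" and ?d = "xs ! l"
  obtain a b c d where abcd: "a = ?a" "b = ?b" "c = ?c" "d = ?d" by blast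
  have xs': "xs = as @ a # bs @ b # cs @ c # ds @ d # fs" using xs unfolding abcd .
  have w: "walk E (as @ a # bs @ b # cs @ c # ds @ d # fs)" and dis: "distinct (as @ a # bs @ b # cs @ c # ds @ d # fs)"
    using cyc unfolding cyc_def xs' by blast+
  have close: "{last (d # fs), hd (as @ [a])} \<in> E"
  proof -
    have "last xs = last (d # fs)" "hd xs = hd (as @ [a])" by (simp_all add: xs' hd_append)
    then show ?thesis using cyc unfolding cyc_def by simp
  qed
  have w1: "walk E (as @ [a])" "walk E (a # bs @ [b])" "walk E (b # cs @ [c])" "walk E (c # ds @ [d])" "walk E (d # fs)"
    using w walk_split[of E as a "bs @ b # cs @ c # ds @ d # fs"] walk_split[of E "a # bs" b "cs @ c # ds @ d # fs"]
      walk_split[of E "b # cs" c "ds @ d # fs"] walk_split[of E "c # ds" d fs] by simp_all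
  \<comment> \<open>The fourth piece of the cycle, from \<open>d\<close> to \<open>a\<close>, runs
    over the closing edge.\<close>
  have "walk E ((d # fs) @ (as @ [a]))"
    by (rule successively_append_iff[THEN iffD2]) (use w1 close in blast)
  then have "walk E (d # (fs @ as) @ [a])" by simp
  moreover have "distinct (a # b # c # d # bs @ cs @ ds @ (fs @ as))" using dis by auto
  ultimately show False
    using \<open>crossing_free E\<close> w1(2-4) ch unfolding crossing_free_def abcd by blast
qed

section \<open>Gluing colourings\<close>

text \<open>The middle edge is quantified together with one further edge at each of its ends. For
  \<open>a = b\<close> the three edges form a triangle, so paths and triangles are treated
  alike.\<close>

definition injective_on :: "'a set set \<Rightarrow> ('a set \<Rightarrow> nat) \<Rightarrow> bool" where
  "injective_on E c \<longleftrightarrow>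
     (\<forall>u v a b. {u, v} \<in> E \<longrightarrow> {u, a} \<in> E \<longrightarrow> {v, b} \<in> E \<longrightarrow> a \<noteq> v \<longrightarrow> b \<noteq> u \<longrightarrow> c {u, a} \<noteq> c {v, b})"

text \<open>
  The root \<open>y\<close> is thought of as carrying one more edge, of colour \<open>d\<close>, whose other end meets further
  edges with the colours in \<open>S\<close>. As 0 is not a colour, \<open>d = 0\<close> together with \<open>S = {}\<close> means no condition.
\<close>

definition rooted_coloring :: "'a set set \<Rightarrow> 'a \<Rightarrow> nat \<Rightarrow> nat set \<Rightarrow> ('a set \<Rightarrow> nat) \<Rightarrow> bool" where
  "rooted_coloring E y d S c \<longleftrightarrow> (\<forall>e\<in>E. c e \<in> {1..5}) \<and> injective_on E c \<and>
     (\<forall>z. {y, z} \<in> E \<longrightarrow> c {y, z} \<notin> S) \<and>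
     (\<forall>z t. {y, z} \<in> E \<longrightarrow> {z, t} \<in> E \<longrightarrow> t \<noteq> y \<longrightarrow> c {z, t} \<noteq> d)"

lemma injective_onD:
  "injective_on E c \<Longrightarrow> {u, v} \<in> E \<Longrightarrow> {u, a} \<in> E \<Longrightarrow> {v, b} \<in> E \<Longrightarrow> a \<noteq> v \<Longrightarrow> b \<noteq> u \<Longrightarrow>
     c {u, a} \<noteq> c {v, b}"
  unfolding injective_on_def by blast

text \<open>The bridge itself is coloured with \<open>E1\<close>. Edges of the two parts conflict
  only in two ways: the bridge with edges one step beyond those at \<open>z\<close>, and other edges
  at \<open>x\<close> with edges at \<open>z\<close>. These are the two prescriptions handed to
  \<open>c2\<close>. For \<open>x = y\<close> the imaginary edge at the root is one more edge at
  \<open>x\<close>, so \<open>d\<close> joins the set.\<close>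

lemma glue_bridge:
  assumes doubleton: "\<forall>e\<in>E. card e = 2" and xz: "{x, z} \<in> E" and R: "x \<notin> R" "z \<in> R" "y \<notin> R"
    and closed: "\<And>u v. u \<in> R \<Longrightarrow> {u, v} \<in> E \<Longrightarrow> {u, v} \<noteq> {x, z} \<Longrightarrow> v \<in> R"
    and E2: "E2 = {e \<in> E. e \<noteq> {x, z} \<and> e \<inter> R \<noteq> {}}" and E1: "E1 = E - E2"
    and c1: "rooted_coloring E1 y d S c1"
    and c2: "rooted_coloring E2 z (c1 {x, z}) ({c1 {x, t} |t. t \<noteq> z \<and> {x, t} \<in> E1} \<union> (if x = y then {d} else {})) c2"
  shows "rooted_coloring E y d S (\<lambda>e. if e \<in> E2 then c2 e else c1 e)"
proof -
  define c where "c = (\<lambda>e. if e \<in> E2 then c2 e else c1 e)"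
  have neq: "u \<noteq> v" if "{u, v} \<in> E" for u v using doubleton that by fastforce
  have "x \<noteq> z" using neq[OF xz] .
  have xz1: "{x, z} \<in> E1" using xz E1 E2 by blast
  have in2: "{u, v} \<in> E2 \<and> v \<in> R" if "{u, v} \<in> E" "u \<in> R" "{u, v} \<noteq> {x, z}" for u v
    using that closed[of u v] E2 by auto
  have in1: "{u, v} \<in> E1" if "{u, v} \<in> E" "u \<notin> R" for u v
  proof (cases "v \<in> R \<and> {u, v} \<noteq> {x, z}")
    case True
    then have "u \<in> R" using closed[of v u] that(1) by (simp add: insert_commute)
    then show ?thesis using that by simp
  next
    case False
    then show ?thesis using that E1 E2 xz1 by auto
  qed
  have v1: "c e = c1 e" if "e \<in> E1" for e using that E1 by (auto simp: c_def)
  have v2: "c e = c2 e" if "e \<in> E2" for e using that by (auto simp: c_def)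
  note c1D = c1[unfolded rooted_coloring_def] and c2D = c2[unfolded rooted_coloring_def]
  have bridge: "c {x, t} \<noteq> c {z, b}" if "{x, t} \<in> E" "{z, b} \<in> E" "t \<noteq> z" "b \<noteq> x" for t b
  proof -
    have b: "{z, b} \<in> E2" using in2[of z b] that R by (auto simp: doubleton_eq_iff)
    have t: "{x, t} \<in> E1" using in1 that R by blast
    have "c2 {z, b} \<notin> {c1 {x, t} |t. t \<noteq> z \<and> {x, t} \<in> E1}" using c2D b by blast
    then have "c2 {z, b} \<noteq> c1 {x, t}" using t that(3) by blast
    then show ?thesis using v1[OF t] v2[OF b] by simp
  qed
  have beyond: "c {z, x} \<noteq> c {v, b}" if "{z, v} \<in> E" "{v, b} \<in> E" "x \<noteq> v" "b \<noteq> z" for v b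
  proof -
    have v: "{z, v} \<in> E2" "v \<in> R" using in2[of z v] that R by (auto simp: doubleton_eq_iff)
    then have b: "{v, b} \<in> E2"
      using in2[of v b] that R neq[OF that(1)] by (auto simp: doubleton_eq_iff)
    have "c2 {v, b} \<noteq> c1 {x, z}" using c2D v(1) b that(4) by blast
    then show ?thesis using v1[OF xz1] v2[OF b] by (simp add: insert_commute)
  qed
  have inj: "injective_on E c"
    unfolding injective_on_def
  proof (intro allI impI)
    fix u v a b assume uv: "{u, v} \<in> E" and ua: "{u, a} \<in> E" and vb: "{v, b} \<in> E" and ne: "a \<noteq> v" "b \<noteq> u"
    consider "u = x" "v = z" | "u = z" "v = x" | "u \<in> R" "{u, v} \<noteq> {x, z}" | "u \<notin> R" "{u, v} \<noteq> {x, z}"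
      by (auto simp: doubleton_eq_iff)
    then show "c {u, a} \<noteq> c {v, b}"
    proof cases
      case 1
      then show ?thesis using bridge[of a b] ua vb ne by simp
    next
      case 2
      then show ?thesis using bridge[of b a] ua vb ne by (metis)
    next
      case 3
      then have v: "{u, v} \<in> E2" "v \<in> R" using in2[OF uv] by auto
      have "{v, u} \<in> E2" using v by (simp add: insert_commute)
      consider "u = z" "a = x" | "v = z" "b = x" | "{u, a} \<noteq> {x, z}" "{v, b} \<noteq> {x, z}"
        using 3 v R by (auto simp: doubleton_eq_iff)
      then show ?thesis
      proof cases
        case 1
        then show ?thesis using beyond[of v b] uv vb ne by simp
      next
        case 2
        then show ?thesis using beyond[of u a] uv ua ne by (metis insert_commute)
      next
        case 3
        then have "{u, a} \<in> E2" "{v, b} \<in> E2" using in2 ua vb v \<open>u \<in> R\<close> by blast+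
        then show ?thesis using injective_onD[of E2 c2 u v a b] c2D v ne v2 by simp
      qed
    next
      case 4
      have "v \<notin> R"
        using closed[of v u] uv 4 by (auto simp: insert_commute)
      then have "{u, v} \<in> E1" "{u, a} \<in> E1" "{v, b} \<in> E1" using in1 uv ua vb 4 by blast+
      then show ?thesis using injective_onD[of E1 c1 u v a b] c1D ne v1 by simp
    qed
  qed
  have r1: "c {y, t} \<notin> S" if "{y, t} \<in> E" for t
  proof -
    have t: "{y, t} \<in> E1" using in1 that R by blast
    then have "c1 {y, t} \<notin> S" using c1D by blast
    then show ?thesis using v1[OF t] by simp
  qed
  have r2: "c {t, s} \<noteq> d" if ts: "{y, t} \<in> E" "{t, s} \<in> E" "s \<noteq> y" for t s
  proof -
    have t: "{y, t} \<in> E1" using in1 ts(1) R by blast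
    show ?thesis
    proof (cases "{t, s} \<in> E1")
      case True
      then have "c1 {t, s} \<noteq> d" using c1D t ts(3) by blast
      then show ?thesis using v1[OF True] by simp
    next
      case False
      then have "t \<in> R" using in1[OF ts(2)] by blast
      then have "{y, t} = {x, z}"
        using in2[of t y] ts(1) R(3) by (auto simp: insert_commute)
      then have "y = x" "t = z" using R \<open>t \<in> R\<close> by (auto simp: doubleton_eq_iff)
      moreover have s: "{t, s} \<in> E2" using False ts(2) E1 by blast
      ultimately have "c2 {t, s} \<noteq> d" using c2D by auto
      then show ?thesis using v2[OF s] by simp
    qed
  qed
  have "c e \<in> {1..5}" if "e \<in> E" for e
    using that c1D c2D E1 v1[of e] v2[of e] by (cases "e \<in> E2") auto
  then have "rooted_coloring E y d S c" unfolding rooted_coloring_def using inj r1 r2 by blast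
  then show ?thesis by (simp only: c_def)
qed

lemma glue_components:
  assumes R: "y \<notin> R" and closed: "\<And>u v. u \<in> R \<Longrightarrow> {u, v} \<in> E \<Longrightarrow> v \<in> R"
    and c1: "rooted_coloring {e \<in> E. e \<inter> R = {}} y d S c1"
    and c2: "rooted_coloring {e \<in> E. e \<inter> R \<noteq> {}} w 0 {} c2"
  shows "rooted_coloring E y d S (\<lambda>e. if e \<inter> R = {} then c1 e else c2 e)"
proof -
  let ?c = "\<lambda>e. if e \<inter> R = {} then c1 e else c2 e"
  have R_iff: "u \<in> R \<longleftrightarrow> v \<in> R" if "{u, v} \<in> E" for u v
    using closed[of u v] closed[of v u] that by (auto simp: insert_commute)
  have "injective_on E ?c"
    unfolding injective_on_def
  proof (intro allI impI)
    fix u v a b assume e: "{u, v} \<in> E" "{u, a} \<in> E" "{v, b} \<in> E" and ne: "a \<noteq> v" "b \<noteq> u"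
    show "?c {u, a} \<noteq> ?c {v, b}"
    proof (cases "u \<in> R")
      case True
      then have "v \<in> R" using R_iff e by blast
      with True show ?thesis
        using injective_onD[of "{e \<in> E. e \<inter> R \<noteq> {}}" c2 u v a b] c2 e ne unfolding rooted_coloring_def by simp
    next
      case False
      then have "v \<notin> R" "a \<notin> R" "b \<notin> R" using R_iff e by blast+
      with False show ?thesis
        using injective_onD[of "{e \<in> E. e \<inter> R = {}}" c1 u v a b] c1 e ne unfolding rooted_coloring_def by simp
    qed
  qed
  moreover have "?c {y, z} \<notin> S" if "{y, z} \<in> E" for z
  proof -
    have "{y, z} \<inter> R = {}" using R_iff[OF that] R by simp
    then show ?thesis using c1 that unfolding rooted_coloring_def by simp
  qed
  moreover have "?c {z, t} \<noteq> d" if "{y, z} \<in> E" "{z, t} \<in> E" "t \<noteq> y" for z t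
  proof -
    have "{y, z} \<inter> R = {}" "{z, t} \<inter> R = {}" using R_iff[OF that(1)] R_iff[OF that(2)] R by simp_all
    then show ?thesis using c1 that unfolding rooted_coloring_def by simp
  qed
  moreover have "?c e \<in> {1..5}" if "e \<in> E" for e
    using that c1 c2 unfolding rooted_coloring_def by simp
  ultimately show ?thesis unfolding rooted_coloring_def by blast
qed

section \<open>A longest cycle through the root\<close>

locale indexed_cycle =
  fixes E :: "'a set set" and xs :: "'a list" and n :: nat
  assumes so: "subcubic_outer E" and cyc: "cyc E xs" and len: "length xs = Suc n"

begin

definition nx :: "nat \<Rightarrow> nat" where "nx i = (if i = n then 0 else i + 1)"
definition pr :: "nat \<Rightarrow> nat" where "pr i = (if i = 0 then n else i - 1)"

lemma n2: "2 \<le> n"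
  using cyc len by (simp add: cyc_def)

lemma nx_pr:
  assumes "i \<le> n"
  shows "nx i \<le> n" "pr i \<le> n" "nx (pr i) = i" "pr (nx i) = i" "nx i \<noteq> i" "pr i \<noteq> i" "nx i \<noteq> pr i"
  using assms n2 by (auto simp: nx_def pr_def)

lemma nth_eq: "i \<le> n \<Longrightarrow> j \<le> n \<Longrightarrow> xs ! i = xs ! j \<longleftrightarrow> i = j"
  using cyc len by (simp add: cyc_def nth_eq_iff_index_eq)

lemma nth_mem: "i \<le> n \<Longrightarrow> xs ! i \<in> set xs"
  using len by simp

lemma ex_index: "u \<in> set xs \<Longrightarrow> \<exists>i\<le>n. u = xs ! i"
  using len by (metis in_set_conv_nth less_Suc_eq_le)

lemma edge_nx:
  assumes "i \<le> n"
  shows "{xs ! i, xs ! nx i} \<in> E"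
proof (cases "i = n")
  case True
  have "xs \<noteq> []" using len by auto
  then have "last xs = xs ! n" "hd xs = xs ! 0" using len by (simp_all add: last_conv_nth hd_conv_nth)
  then show ?thesis using cyc True by (simp add: cyc_def nx_def)
next
  case False
  then have "Suc i < length xs" using assms len by simp
  then show ?thesis
    using cyc False unfolding cyc_def successively_conv_nth by (simp add: nx_def)
qed

lemma edge_pr: "i \<le> n \<Longrightarrow> {xs ! i, xs ! pr i} \<in> E"
  using edge_nx[of "pr i"] nx_pr[of i] by (simp add: insert_commute)

text \<open>The two cycle edges at a vertex of degree at most 3 leave room for only one
  more.\<close>

lemma third_unique:
  assumes i: "i \<le> n" and "{xs ! i, s} \<in> E" "s \<noteq> xs ! nx i" "s \<noteq> xs ! pr i"
    and "{xs ! i, t} \<in> E" "t \<noteq> xs ! nx i" "t \<noteq> xs ! pr i"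
  shows "s = t"
proof (rule ccontr)
  assume "s \<noteq> t"
  have fin: "finite (nbs E (xs ! i))" using so by (auto simp: subcubic_outer_def intro: finite_nbs)
  have "xs ! nx i \<noteq> xs ! pr i" using nth_eq nx_pr[OF i] by simp
  then have "card {s, t, xs ! nx i, xs ! pr i} = 4" using assms \<open>s \<noteq> t\<close> by auto
  moreover have "{s, t, xs ! nx i, xs ! pr i} \<subseteq> nbs E (xs ! i)"
    using assms edge_nx edge_pr by (simp add: nbs_def)
  then have "card {s, t, xs ! nx i, xs ! pr i} \<le> card (nbs E (xs ! i))" by (rule card_mono[OF fin])
  moreover have "card (nbs E (xs ! i)) \<le> 3" using so by (simp add: subcubic_outer_def)
  ultimately show False by simp
qed

definition chord :: "nat \<Rightarrow> nat \<Rightarrow> bool" where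
  "chord i j \<longleftrightarrow> i \<le> n \<and> j \<le> n \<and> {xs ! i, xs ! j} \<in> E \<and> j \<noteq> nx i \<and> j \<noteq> pr i"

lemma chord_sym: "chord i j \<Longrightarrow> chord j i"
  using nx_pr[of i] nx_pr[of j] by (auto simp: chord_def insert_commute)

lemma chord_unique: "chord i j \<Longrightarrow> chord i k \<Longrightarrow> j = k"
  using third_unique[of i "xs ! j" "xs ! k"] nth_eq nx_pr[of i] by (auto simp: chord_def)

lemma chord_neq: "chord i j \<Longrightarrow> i \<noteq> j"
  using so by (auto simp: chord_def subcubic_outer_def)

text \<open>Encodes the chords as an involution that fixes the vertices without a chord, the form in
  which \<open>cycle_colouring\<close> takes them.\<close>

definition mate :: "nat \<Rightarrow> nat" where
  "mate i = (if \<exists>j. chord i j then THE j. chord i j else i)"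

lemma mate_eq: "chord i j \<Longrightarrow> mate i = j"
  unfolding mate_def using chord_unique by (auto intro: the_equality)

lemma mate_chord: "mate i \<noteq> i \<Longrightarrow> chord i (mate i)"
  using mate_eq by (metis mate_def)

lemma mate_mate: "mate (mate i) = i"
  using mate_chord[of i] chord_sym mate_eq by metis

lemma mate_le: "i \<le> n \<Longrightarrow> mate i \<le> n"
  using mate_chord[of i] chord_def by metis

lemma mate_nonadjacent: "mate i \<noteq> i + 1"
  using mate_chord[of i] by (auto simp: chord_def nx_def split: if_splits)

lemma mate_0: "mate 0 \<noteq> n"
  using mate_chord[of 0] n2 by (auto simp: chord_def pr_def)

lemma chords_uncrossed:
  assumes "chord i k" "chord j l" "i < j" "j < k" "k < l"
  shows False
  using cyc_crossing[OF cyc, of i j k l] so assms len by (auto simp: chord_def subcubic_outer_def)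

lemma mate_noncrossing:
  assumes "i < j" "j < mate i"
  shows "i < mate j \<and> mate j < mate i"
proof (cases "mate j = j")
  case False
  have ci: "chord i (mate i)" using mate_chord assms by simp
  have cj: "chord j (mate j)" using mate_chord False by simp
  have "mate j \<noteq> i" "mate j \<noteq> mate i" using mate_mate[of j] mate_mate[of i] assms by auto
  moreover have "\<not> mate i < mate j" using chords_uncrossed[OF ci cj] assms by blast
  moreover have "\<not> mate j < i" using chords_uncrossed[OF chord_sym[OF cj] ci] assms by blast
  ultimately show ?thesis by linarith
qed (use assms in simp)

end

text \<open>What remains when bridges cut off nothing but leaves: the cycle, its chords and pendant
  edges.\<close>

locale spanned_cycle = indexed_cycle +
  assumes touch: "\<And>e. e \<in> E \<Longrightarrow> e \<inter> set xs \<noteq> {}"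
    and leaf: "\<And>u z. u \<in> set xs \<Longrightarrow> {u, z} \<in> E \<Longrightarrow> z \<notin> set xs \<Longrightarrow> nbs E z = {u}"
begin

lemma spanned_cycle_coloring:
  assumes root: "card (nbs E (hd xs)) \<le> 2 \<or> d = 0 \<and> S = {}" and S: "card (S \<inter> {1..5}) \<le> 2"
  shows "\<exists>c. rooted_coloring E (hd xs) d S c"
proof -
  have hd: "hd xs = xs ! 0" using len by (metis hd_conv_nth list.size(3) nat.distinct(1))
  have fin: "finite (nbs E v)" for v using so by (auto simp: subcubic_outer_def intro: finite_nbs)
  have deg2: "t = xs ! nx 0 \<or> t = xs ! pr 0" if "card (nbs E (hd xs)) \<le> 2" "{xs ! 0, t} \<in> E" for t
  proof (rule ccontr)
    assume t: "\<not> ?thesis"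
    have "xs ! nx 0 \<noteq> xs ! pr 0" using nth_eq nx_pr[of 0] by simp
    then have "card {t, xs ! nx 0, xs ! pr 0} = 3" using t by auto
    moreover have "{t, xs ! nx 0, xs ! pr 0} \<subseteq> nbs E (hd xs)"
      using that edge_nx[of 0] edge_pr[of 0] by (simp add: nbs_def hd)
    then have "card {t, xs ! nx 0, xs ! pr 0} \<le> card (nbs E (hd xs))" by (rule card_mono[OF fin])
    ultimately show False using that(1) by simp
  qed
  \<comment> \<open>A root with at most two edges spends both on the cycle and has no chord.\<close>
  have "mate 0 = 0 \<or> d = 0 \<and> S = {}"
  proof (rule ccontr)
    assume neg: "\<not> ?thesis"
    then have "chord 0 (mate 0)" using mate_chord by blast
    moreover have "card (nbs E (hd xs)) \<le> 2" using root neg by blast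
    ultimately show False
      using deg2[of "xs ! mate 0"] nth_eq nx_pr[of 0] by (auto simp: chord_def)
  qed
  then obtain x y where range: "\<forall>i\<le>n. x i \<in> {1..5} \<and> y i \<in> {1..5} \<and> y (mate i) = y i"
    and path: "\<forall>i\<le>n. {x (pr i), y i} \<inter> {x (nx i), y (nx i)} = {}"
    and ch: "\<forall>i\<le>n. mate i \<noteq> i \<longrightarrow> {x (pr i), x i} \<inter> {x (pr (mate i)), x (mate i)} = {}"
    and x0: "x 0 \<notin> S" "x n \<notin> S" and y0: "d \<in> {1..5} \<longrightarrow> y 0 = d"
    using cycle_colouring[of mate n d S, OF mate_mate mate_nonadjacent mate_noncrossing n2 mate_le mate_0 _ S]
    unfolding pr_def nx_def by blast
  \<comment> \<open>\<open>K i v\<close> is the colour of the edge from \<open>xs ! i\<close> to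
    \<open>v\<close>, read off at index \<open>i\<close>. An edge with both ends on the cycle can be
    read off at either end, and \<open>K_sym\<close> says that the results agree.\<close>
  define K where "K = (\<lambda>i v. if v = xs ! nx i then x i else if v = xs ! pr i then x (pr i) else y i)"
  have K_sym: "K i (xs ! j) = K j (xs ! i)" if ij: "i \<le> n" "j \<le> n" "{xs ! i, xs ! j} \<in> E" for i j
  proof -
    consider "j = nx i" | "j = pr i" | "chord i j" using ij by (auto simp: chord_def)
    then show ?thesis
    proof cases
      case 1
      then have "i = pr j" "i \<noteq> nx j" using nx_pr[OF ij(1)] nx_pr[OF ij(2)] by auto
      then show ?thesis using 1 nth_eq ij nx_pr[OF ij(2)] by (simp add: K_def)
    next
      case 2
      then have "i = nx j" "j \<noteq> nx i" using nx_pr[OF ij(1)] nx_pr[OF ij(2)] by auto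
      then show ?thesis using 2 nth_eq ij nx_pr[OF ij(1)] by (simp add: K_def)
    next
      case 3
      then have "j \<noteq> nx i" "j \<noteq> pr i" "i \<noteq> nx j" "i \<noteq> pr j" using chord_sym[OF 3] by (auto simp: chord_def)
      moreover have "y j = y i" using mate_eq[OF 3] range ij by auto
      ultimately show ?thesis using nth_eq ij nx_pr[OF ij(1)] nx_pr[OF ij(2)] by (simp add: K_def)
    qed
  qed
  \<comment> \<open>An edge does not determine the index at which it is read off; by
    \<open>K_sym\<close> every choice yields the same colour.\<close>
  define c where "c = (\<lambda>e. SOME k. \<exists>i\<le>n. \<exists>v. e = {xs ! i, v} \<and> k = K i v)"
  have c: "c {xs ! i, v} = K i v" if iv: "i \<le> n" "{xs ! i, v} \<in> E" for i v
    unfolding c_def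
  proof (rule some_equality)
    show "\<exists>j\<le>n. \<exists>w. {xs ! i, v} = {xs ! j, w} \<and> K i v = K j w" using iv by blast
    fix k assume "\<exists>j\<le>n. \<exists>w. {xs ! i, v} = {xs ! j, w} \<and> k = K j w"
    then obtain j w where j: "j \<le> n" "{xs ! i, v} = {xs ! j, w}" "k = K j w" by blast
    then consider "xs ! i = xs ! j" "v = w" | "xs ! i = w" "v = xs ! j" by (auto simp: doubleton_eq_iff)
    then show "k = K i v"
    proof cases
      case 1
      then show ?thesis using nth_eq j iv by simp
    next
      case 2
      then show ?thesis using K_sym[of i j] j iv by simp
    qed
  qed
  have K_range: "K i v \<in> {1..5}" if "i \<le> n" for i v using range nx_pr[OF that] that by (auto simp: K_def)
  have K_nx: "K i a \<in> {x (pr i), y i}" if "a \<noteq> xs ! nx i" for i a using that by (simp add: K_def)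
  have K_pr: "K i a \<in> {x i, y i}" if "a \<noteq> xs ! pr i" for i a using that by (simp add: K_def)
  \<comment> \<open>A vertex with two edges is no leaf, so it lies on the cycle. Hence conflicts
    arise only along cycle edges and chords.\<close>
  have on_cycle: "u \<in> set xs" if "{u, v} \<in> E" "{u, a} \<in> E" "a \<noteq> v" for u v a
  proof (rule ccontr)
    assume u: "u \<notin> set xs"
    then have "v \<in> set xs" using touch[OF that(1)] by auto
    then have "nbs E u = {v}" using leaf[of v u] that(1) u by (simp add: insert_commute)
    then show False using that(2,3) by (auto simp: nbs_def)
  qed
  have "injective_on E c"
    unfolding injective_on_def
  proof (intro allI impI)
    fix u v a b assume uv: "{u, v} \<in> E" and ua: "{u, a} \<in> E" and vb: "{v, b} \<in> E" and ne: "a \<noteq> v" "b \<noteq> u"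
    have "u \<in> set xs" using on_cycle uv ua ne by blast
    then obtain i where i: "i \<le> n" "u = xs ! i" using ex_index by blast
    have "v \<in> set xs" using on_cycle[of v u b] uv vb ne by (simp add: insert_commute)
    then obtain j where j: "j \<le> n" "v = xs ! j" using ex_index by blast
    have ca: "c {u, a} = K i a" and cb: "c {v, b} = K j b" using c i j ua vb by simp_all
    consider "j = nx i" | "j = pr i" | "chord i j" using uv i j by (auto simp: chord_def)
    then show "c {u, a} \<noteq> c {v, b}"
    proof cases
      case 1
      have "K i a \<in> {x (pr i), y i}" using K_nx ne 1 j by simp
      moreover have "K j b \<in> {x (nx i), y (nx i)}" using K_pr[of b j] ne 1 i nx_pr[OF i(1)] by simp
      ultimately show ?thesis using path i ca cb by (metis disjoint_iff)
    next
      case 2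
      then have "i = nx j" using nx_pr[OF i(1)] by simp
      have "a \<noteq> xs ! pr i" using ne(1) j(2) 2 by simp
      then have A: "K i a \<in> {x i, y i}" by (rule K_pr)
      have "b \<noteq> xs ! nx j" using ne(2) i(2) \<open>i = nx j\<close> by simp
      then have B: "K j b \<in> {x (pr j), y j}" by (rule K_nx)
      have "{x (pr j), y j} \<inter> {x i, y i} = {}"
        using path[rule_format, OF j(1)] unfolding \<open>i = nx j\<close>[symmetric] .
      then show ?thesis using A B unfolding ca cb by (metis disjoint_iff)
    next
      case 3
      \<comment> \<open>The chord is already the third edge at \<open>xs ! i\<close>, so any other
        edge there belongs to the cycle.\<close>
      have "a = xs ! nx i \<or> a = xs ! pr i"
      proof (rule ccontr)
        assume "\<not> ?thesis"
        moreover have "v \<noteq> xs ! nx i" "v \<noteq> xs ! pr i"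
          using 3 j nth_eq nx_pr(1,2)[OF i(1)] by (simp_all add: chord_def)
        ultimately have "a = v" using third_unique[OF i(1)] ua uv i(2) by blast
        then show False using ne by simp
      qed
      then have A: "K i a \<in> {x (pr i), x i}" by (auto simp: K_def)
      have "b = xs ! nx j \<or> b = xs ! pr j"
      proof (rule ccontr)
        assume "\<not> ?thesis"
        moreover have "u \<noteq> xs ! nx j" "u \<noteq> xs ! pr j"
          using chord_sym[OF 3] i nth_eq nx_pr(1,2)[OF j(1)] by (simp_all add: chord_def)
        moreover have "{v, u} \<in> E" using uv by (simp add: insert_commute)
        ultimately have "b = u" using third_unique[OF j(1)] vb j(2) by blast
        then show False using ne by simp
      qed
      then have B: "K j b \<in> {x (pr j), x j}" by (auto simp: K_def)
      have "mate i = j" "i \<noteq> j" using mate_eq[OF 3] chord_neq[OF 3] by auto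
      then have "{x (pr i), x i} \<inter> {x (pr j), x j} = {}" using ch[rule_format, OF i(1)] by simp
      then show ?thesis using A B unfolding ca cb by (metis disjoint_iff)
    qed
  qed
  moreover have "c e \<in> {1..5}" if e: "e \<in> E" for e
  proof -
    obtain u where "u \<in> e" "u \<in> set xs" using touch[OF e] by blast
    moreover have "\<exists>v. e = {u, v}" if "u \<in> e" for u
    proof -
      have "card e = 2" using so e by (simp add: subcubic_outer_def)
      then show ?thesis using that by (auto simp: card_2_iff)
    qed
    ultimately obtain i v where "i \<le> n" "e = {xs ! i, v}" using ex_index by metis
    then show ?thesis using c[of i v] K_range e by simp
  qed
  moreover have "c {xs ! 0, z} \<notin> S" if z: "{xs ! 0, z} \<in> E" for z
  proof (cases "S = {}")
    case False
    then have "z = xs ! nx 0 \<or> z = xs ! pr 0" using deg2 z root by blast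
    then have "K 0 z \<in> {x 0, x (pr 0)}" by (auto simp: K_def)
    moreover have "pr 0 = n" by (simp add: pr_def)
    ultimately show ?thesis using c[of 0 z] z x0 by auto
  qed simp
  moreover have "c {z, t} \<noteq> d" if zt: "{xs ! 0, z} \<in> E" "{z, t} \<in> E" "t \<noteq> xs ! 0" for z t
  proof (cases "d \<in> {1..5}")
    case True
    then have d: "y 0 = d" "card (nbs E (hd xs)) \<le> 2" using y0 root by auto
    consider "z = xs ! nx 0" | "z = xs ! pr 0" using deg2[OF d(2) zt(1)] by blast
    then show ?thesis
    proof cases
      case 1
      have "K (nx 0) t \<in> {x (nx 0), y (nx 0)}" using K_pr[of t "nx 0"] zt nx_pr[of 0] by simp
      moreover have "c {z, t} = K (nx 0) t" using c[of "nx 0" t] 1 zt nx_pr[of 0] by simp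
      ultimately show ?thesis using path d by (metis disjoint_iff insertCI le0)
    next
      case 2
      have "K (pr 0) t \<in> {x (pr (pr 0)), y (pr 0)}" using K_nx[of t "pr 0"] zt nx_pr[of 0] by simp
      moreover have "c {z, t} = K (pr 0) t" using c[of "pr 0" t] 2 zt nx_pr[of 0] by simp
      moreover have "{x (pr (pr 0)), y (pr 0)} \<inter> {x 0, y 0} = {}"
        using path nx_pr[of 0] by (metis le0)
      ultimately show ?thesis using d by auto
    qed
  next
    case False
    then show ?thesis using \<open>\<And>e. e \<in> E \<Longrightarrow> c e \<in> {1..5}\<close> zt(2) by metis
  qed
  ultimately show ?thesis unfolding rooted_coloring_def hd by blast
qed

end

lemma card_2_other:
  assumes "card e = 2" "u \<in> e"
  shows "\<exists>v. e = {u, v}"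
proof -
  obtain x y where "e = {x, y}" using assms(1) by (auto simp: card_2_iff)
  then show ?thesis using assms(2) by (auto simp: insert_commute)
qed

lemma indexed_cycleI:
  assumes "subcubic_outer E" "cyc E xs"
  shows "indexed_cycle E xs (length xs - 1)"
proof (rule indexed_cycle.intro)
  have "3 \<le> length xs" using assms(2) unfolding cyc_def by (rule conjunct1)
  then show "length xs = Suc (length xs - 1)" by simp
qed (fact assms)+

section \<open>Edges that leave a longest cycle\<close>

lemma (in indexed_cycle) no_two_chords:
  assumes "u \<in> set xs" "{u, s} \<in> E" "{u, t} \<in> E" "s \<notin> set xs" "t \<notin> set xs"
  shows "s = t"
proof -
  obtain i where i: "i \<le> n" "u = xs ! i" using ex_index assms(1) by blast
  then show ?thesis
    using third_unique[OF i(1), of s t] nth_mem nx_pr(1,2)[OF i(1)] assms by metis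
qed

lemma reach_closed:
  assumes "z \<in> W" "\<And>u v. u \<in> W \<Longrightarrow> {u, v} \<in> F \<Longrightarrow> v \<in> W"
  shows "reach F z \<subseteq> W"
proof
  fix v assume "v \<in> reach F z"
  then show "v \<in> W" unfolding reach_def mem_Collect_eq
    by (induction rule: rtrancl_induct) (use assms in auto)
qed

text \<open>A return from \<open>z\<close> to the cycle avoiding \<open>{u, z}\<close> would end
  either at \<open>u\<close>, through a second edge off the cycle against the degree bound, or at
  another vertex, and then it forms with \<open>{u, z}\<close> an ear that lengthens the cycle. So
  \<open>{u, z}\<close> is a bridge.\<close>

lemma longest_cycle_leaf:
  assumes so: "subcubic_outer E" and cyc: "cyc E xs"
    and longest: "\<And>ys. cyc E ys \<Longrightarrow> hd ys = hd xs \<Longrightarrow> length ys \<le> length xs"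
    and u: "u \<in> set xs" "{u, z} \<in> E" "z \<notin> set xs"
  shows "reach (E - {{u, z}}) z \<inter> set xs = {}"
proof (rule ccontr)
  interpret indexed_cycle E xs "length xs - 1"
    by (rule indexed_cycleI[OF so cyc])
  assume "reach (E - {{u, z}}) z \<inter> set xs \<noteq> {}"
  then obtain ws w where ws: "walk (E - {{u, z}}) (z # ws @ [w])" "distinct (z # ws)" "w \<in> set xs"
    "set (z # ws) \<inter> set xs = {}" using reach_first_hit[OF _ u(3)] by metis
  have walk: "walk E (u # (z # ws) @ [w])"
    using walk_mono[OF ws(1), of E] u(2) by auto
  show False
  proof (cases "w = u")
    case True
    have last: "{last (z # ws), u} \<in> E - {{u, z}}"
      using ws(1) True successively_append_iff[of "\<lambda>a b. {a, b} \<in> E - {{u, z}}" "z # ws" "[w]"] by simp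
    have "last (z # ws) \<notin> set xs" using ws(4) last_in_set[of "z # ws"] by blast
    moreover have "{u, last (z # ws)} \<in> E" using last by (metis DiffD1 insert_commute)
    ultimately have "last (z # ws) = z" using no_two_chords[OF u(1)] u(2,3) by metis
    then show False using last by (metis DiffD2 insert_commute singletonI)
  next
    case False
    have "theta_free E" using so by (simp add: subcubic_outer_def)
    from cyc_ear_ends[OF cyc u(1) ws(3) False[symmetric] this walk ws(2)] ws(4)
    obtain xs' where "cyc E xs'" "hd xs' = hd xs" "length xs < length xs'" by blast
    then show False using longest[of xs'] by simp
  qed
qed

lemma ex_longest_cycle:
  assumes so: "subcubic_outer E" and "cyc E xs0"
  obtains xs where "cyc E xs" "hd xs = hd xs0" "\<And>ys. cyc E ys \<Longrightarrow> hd ys = hd xs \<Longrightarrow> length ys \<le> length xs"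
proof -
  have fin: "finite (\<Union>E)" using so unfolding subcubic_outer_def by (metis card.infinite finite_Union zero_neq_numeral)
  have bound: "length ys < Suc (card (\<Union>E))" if "cyc E ys" for ys
  proof -
    interpret indexed_cycle E ys "length ys - 1"
      by (rule indexed_cycleI[OF so that])
    have "set ys \<subseteq> \<Union>E" using ex_index edge_nx by blast
    then have "card (set ys) \<le> card (\<Union>E)" using fin by (rule card_mono[rotated])
    moreover have "card (set ys) = length ys" using that by (simp add: cyc_def distinct_card)
    ultimately show ?thesis by simp
  qed
  let ?P = "\<lambda>ys. cyc E ys \<and> hd ys = hd xs0"
  have "\<exists>xs. ?P xs \<and> (\<forall>ys. ?P ys \<longrightarrow> length ys \<le> length xs)"
    by (rule ex_has_greatest_nat[of ?P xs0 length "Suc (card (\<Union>E))"]) (use assms bound in auto)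
  then show ?thesis using that by metis
qed

section \<open>The upper bound\<close>

theorem ex_rooted_coloring:
  assumes "subcubic_outer E" "card (nbs E y) \<le> 2 \<or> d = 0 \<and> S = {}" "card (S \<inter> {1..5}) \<le> 2"
  shows "\<exists>c. rooted_coloring E y d S c"
  using assms
proof (induction "card E" arbitrary: E y d S rule: less_induct)
  case less
  note so = less.prems(1)
  have finE: "finite E" and doubleton: "\<forall>e\<in>E. card e = 2" and deg: "card (nbs E v) \<le> 3" for v
    using so by (auto simp: subcubic_outer_def)
  note fin = finite_nbs[OF finE doubleton]
  have IH: "\<exists>c. rooted_coloring F v d' S' c"
    if "F \<subset> E" "card (nbs F v) \<le> 2 \<or> d' = 0 \<and> S' = {}" "card (S' \<inter> {1..5}) \<le> 2" for F v d' S'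
    using less.hyps[of F v d' S'] that subcubic_outer_subset[OF so, of F] psubset_card_mono[OF finE, of F] by blast
  have nbs_mono: "card (nbs F v) \<le> card (nbs E v)" if "F \<subseteq> E" for F v
    using that by (intro card_mono fin) (auto simp: nbs_def)
  \<comment> \<open>A cut at the bridge from \<open>x\<close> to \<open>z\<close>, with the root on
    the side of \<open>x\<close>. As \<open>z\<close> is no leaf, \<open>E2\<close> is nonempty and
    \<open>E1\<close> is smaller than \<open>E\<close>; \<open>E2\<close> is smaller because it
    lacks the bridge.\<close>
  have bridge: "\<exists>c. rooted_coloring E y d S c"
    if root: "card (nbs E y) \<le> 2 \<or> d = 0 \<and> S = {}" "card (S \<inter> {1..5}) \<le> 2"
      and xz: "{x, z} \<in> E" and x: "x \<notin> reach (E - {{x, z}}) z" and y: "y \<notin> reach (E - {{x, z}}) z"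
      and z: "nbs E z \<noteq> {x}" for x z y d S
  proof -
    let ?R = "reach (E - {{x, z}}) z"
    define E2 where "E2 = {e \<in> E. e \<noteq> {x, z} \<and> e \<inter> ?R \<noteq> {}}"
    define E1 where "E1 = E - E2"
    have zR: "z \<in> ?R" by (rule reach_refl)
    obtain t where t: "{z, t} \<in> E" "t \<noteq> x" using z xz by (auto simp: nbs_def insert_commute)
    then have "{z, t} \<in> E2" using zR by (auto simp: E2_def doubleton_eq_iff)
    then have "E1 \<subset> E" using t(1) unfolding E1_def by blast
    moreover from this have "card (nbs E1 y) \<le> card (nbs E y)" by (intro nbs_mono) blast
    then have "card (nbs E1 y) \<le> 2 \<or> d = 0 \<and> S = {}" using root(1) by linarith
    ultimately obtain c1 where c1: "rooted_coloring E1 y d S c1" using IH[of E1 y d S] root(2) by blast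
    let ?T = "(\<lambda>t. c1 {x, t}) ` (nbs E x - {z})"
    let ?S = "{c1 {x, t} |t. t \<noteq> z \<and> {x, t} \<in> E1} \<union> (if x = y then {d} else {})"
    have T: "card ?T \<le> card (nbs E x) - 1" "finite ?T"
    proof -
      have "z \<in> nbs E x" using xz by (simp add: nbs_def)
      then show "card ?T \<le> card (nbs E x) - 1"
        using card_image_le[of "nbs E x - {z}" "\<lambda>t. c1 {x, t}"] fin[of x] by simp
      show "finite ?T" using fin by simp
    qed
    have ST: "{c1 {x, t} |t. t \<noteq> z \<and> {x, t} \<in> E1} \<subseteq> ?T" using E1_def by (auto simp: nbs_def)
    \<comment> \<open>Besides the bridge, \<open>x\<close> has at most two edges. If
      \<open>x\<close> is the root and \<open>d\<close> is not 0, there is at most one, which leaves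
      room for \<open>d\<close>; and \<open>d = 0\<close> is removed by the intersection with the
      colours.\<close>
    have S': "card (?S \<inter> {1..5}) \<le> 2"
    proof (cases "x = y \<and> d \<noteq> 0")
      case True
      then have "card (nbs E x) \<le> 2" using root(1) by auto
      then have "card (insert d ?T) \<le> 2" using T card_insert_le_m1[of 2 ?T d] by simp
      moreover have "card (?S \<inter> {1..5}) \<le> card (insert d ?T)"
        by (rule card_mono) (use T(2) ST in \<open>auto split: if_splits\<close>)
      ultimately show ?thesis by simp
    next
      case False
      have "card (?S \<inter> {1..5}) \<le> card ?T"
        by (rule card_mono) (use T(2) ST False in \<open>auto split: if_splits\<close>)
      then show ?thesis using T(1) deg[of x] by linarith
    qed
    have "nbs E2 z \<subseteq> nbs E z - {x}" by (auto simp: nbs_def E2_def insert_commute)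
    then have "card (nbs E2 z) \<le> card (nbs E z - {x})" using fin by (intro card_mono) auto
    also have "\<dots> = card (nbs E z) - 1"
    proof -
      have "x \<in> nbs E z" using xz by (simp add: nbs_def insert_commute)
      then show ?thesis using fin by simp
    qed
    finally have "card (nbs E2 z) \<le> 2" using deg[of z] by simp
    moreover have "E2 \<subset> E" using xz E2_def by auto
    ultimately obtain c2 where c2: "rooted_coloring E2 z (c1 {x, z}) ?S c2"
      using IH[of E2 z "c1 {x, z}" ?S] S' by blast
    have "rooted_coloring E y d S (\<lambda>e. if e \<in> E2 then c2 e else c1 e)"
      by (rule glue_bridge[OF doubleton xz x zR y _ E2_def E1_def c1 c2]) (auto intro: reach_step)
    then show ?thesis by blast
  qed
  \<comment> \<open>Here the root has an edge. In a counterexample, \<open>bridge\<close> shows that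
    every bridge has a leaf at its end away from the root.\<close>
  have attached: "\<exists>c. rooted_coloring E y d S c"
    if root: "card (nbs E y) \<le> 2 \<or> d = 0 \<and> S = {}" "card (S \<inter> {1..5}) \<le> 2" and y: "nbs E y \<noteq> {}" for y d S
  proof (rule ccontr)
    assume neg: "\<nexists>c. rooted_coloring E y d S c"
    have leaf: "nbs E z = {x}"
      if "{x, z} \<in> E" "x \<notin> reach (E - {{x, z}}) z" "y \<notin> reach (E - {{x, z}}) z" for x z
      using bridge[OF root that] neg by blast
    \<comment> \<open>Otherwise the component of the root and the remaining edges are coloured
      separately, and no conflict arises between them.\<close>
    have conn: "e \<inter> reach E y \<noteq> {}" if e: "e \<in> E" for e
    proof
      assume sep: "e \<inter> reach E y = {}"
      let ?R = "- reach E y"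
      have closed: "v \<in> ?R" if "u \<in> ?R" "{u, v} \<in> E" for u v
        using that reach_step[of v E y u] by (auto simp: insert_commute)
      obtain s where s: "{y, s} \<in> E" using y by (auto simp: nbs_def)
      have "e \<noteq> {}" using doubleton e by force
      then have "{e \<in> E. e \<inter> ?R = {}} \<subset> E" using e sep by blast
      moreover have "card (nbs {e \<in> E. e \<inter> ?R = {}} y) \<le> card (nbs E y)" by (intro nbs_mono) blast
      then have "card (nbs {e \<in> E. e \<inter> ?R = {}} y) \<le> 2 \<or> d = 0 \<and> S = {}" using root(1) by linarith
      ultimately obtain c1 where c1: "rooted_coloring {e \<in> E. e \<inter> ?R = {}} y d S c1"
        using IH[of "{e \<in> E. e \<inter> ?R = {}}" y d S] root(2) by blast
      have "{y, s} \<inter> ?R = {}" using reach_refl[of y E] reach_step[OF reach_refl s] by auto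
      then have "{e \<in> E. e \<inter> ?R \<noteq> {}} \<subset> E" using s by blast
      then obtain c2 where c2: "rooted_coloring {e \<in> E. e \<inter> ?R \<noteq> {}} y 0 {} c2"
        using IH[of "{e \<in> E. e \<inter> ?R \<noteq> {}}" y 0 "{}"] by auto
      have "rooted_coloring E y d S (\<lambda>e. if e \<inter> ?R = {} then c1 e else c2 e)"
        by (rule glue_components[OF _ closed c1 c2]) (simp add: reach_refl)
      then show False using neg by blast
    qed
    show False
    proof (cases "\<forall>s\<in>nbs E y. nbs E s = {y}")
      case True
      have "reach E y \<subseteq> insert y (nbs E y)"
        by (rule reach_closed) (use True in \<open>auto simp: nbs_def\<close>)
      then have star: "u = y \<or> nbs E u = {y}" if "u \<in> reach E y" for u using True that by blast
      have edge: "u = y \<and> nbs E v = {y} \<or> v = y \<and> nbs E u = {y}" if uv: "{u, v} \<in> E" for u v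
      proof -
        have "u \<in> reach E y \<or> v \<in> reach E y" using conn[OF uv] by blast
        then have "u \<in> reach E y" "v \<in> reach E y"
          using reach_step[of u E y v] reach_step[of v E y u] uv by (auto simp: insert_commute)
        moreover have "u \<noteq> v" using uv doubleton by fastforce
        moreover have "v \<in> nbs E u" "u \<in> nbs E v" using uv by (simp_all add: nbs_def insert_commute)
        ultimately show ?thesis using star by blast
      qed
      \<comment> \<open>A star contains no three consecutive edges, so a single colour outside
        \<open>S\<close> is enough.\<close>
      obtain k where k: "k \<in> {1..5}" "k \<notin> S" using ex_colour_notin[of S] root(2) by auto
      have "injective_on E (\<lambda>_. k)"
        unfolding injective_on_def
      proof (intro allI impI)
        fix u v a b assume "{u, v} \<in> E" "{u, a} \<in> E" "{v, b} \<in> E" "a \<noteq> v" "b \<noteq> u"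
        then show "k \<noteq> k" using edge[of u v] by (auto simp: nbs_def)
      qed
      moreover have "False" if "{y, z} \<in> E" "{z, t} \<in> E" "t \<noteq> y" for z t
        using True that by (auto simp: nbs_def)
      ultimately have "rooted_coloring E y d S (\<lambda>_. k)"
        unfolding rooted_coloring_def using k by blast
      then show False using neg by blast
    next
      case False
      \<comment> \<open>The edge from the root to a neighbour that is no leaf cannot be a bridge, so
        it lies on a cycle; reversing \<open>ws\<close> lists that cycle with the root as
        head.\<close>
      then obtain s where s: "{y, s} \<in> E" "nbs E s \<noteq> {y}" by (auto simp: nbs_def)
      then have "y \<in> reach (E - {{y, s}}) s" using leaf[of y s] by blast
      then obtain ws where ws: "walk (E - {{y, s}}) ws" "distinct ws" "ws \<noteq> []" "hd ws = s" "last ws = y"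
        using reach_walk by metis
      have "s \<noteq> y" using s(1) doubleton by fastforce
      have "3 \<le> length ws"
      proof (rule ccontr)
        assume "\<not> 3 \<le> length ws"
        then consider "length ws = 1" | "length ws = 2" using ws(3) by (cases ws) (auto simp: not_le less_Suc_eq numeral_3_eq_3)
        then show False
        proof cases
          case 1
          then show ?thesis using ws(4,5) \<open>s \<noteq> y\<close> by (auto simp: length_Suc_conv)
        next
          case 2
          then have "ws = [s, y]" using ws(4,5) by (auto simp: length_Suc_conv numeral_2_eq_2)
          then show ?thesis using ws(1) by (simp add: insert_commute)
        qed
      qed
      moreover have "walk E (rev ws)" using walk_mono[OF ws(1), of E] walk_rev[of E ws] by auto
      ultimately have "cyc E (rev ws)"
        using ws s(1) unfolding cyc_def by (simp add: hd_rev last_rev insert_commute)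
      from ex_longest_cycle[OF so this] obtain xs where cyc: "cyc E xs" and hd: "hd xs = y"
        and longest: "\<And>ys. cyc E ys \<Longrightarrow> hd ys = hd xs \<Longrightarrow> length ys \<le> length xs"
        using ws(5) by (metis hd_rev)
      have "xs \<noteq> []" using cyc by (auto simp: cyc_def)
      then have y_on: "y \<in> set xs" using hd hd_in_set by metis
      have pendant: "nbs E z = {u}" if u: "u \<in> set xs" "{u, z} \<in> E" "z \<notin> set xs" for u z
        using leaf[OF u(2)] longest_cycle_leaf[OF so cyc longest u] u(1) y_on by blast
      \<comment> \<open>The cycle with its leaves is closed under adjacency, so it contains the
        component of the root, and every edge meets the cycle.\<close>
      let ?W = "set xs \<union> {z. \<exists>u\<in>set xs. nbs E z = {u}}"
      have "reach E y \<subseteq> ?W"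
      proof (rule reach_closed)
        show "y \<in> ?W" using y_on by blast
        show "v \<in> ?W" if uv: "u \<in> ?W" "{u, v} \<in> E" for u v
        proof (cases "u \<in> set xs")
          case True
          then show ?thesis using pendant uv(2) by blast
        next
          case False
          then obtain x where "x \<in> set xs" "nbs E u = {x}" using uv(1) by blast
          moreover have "v \<in> nbs E u" using uv(2) by (simp add: nbs_def)
          ultimately have "v \<in> set xs" by simp
          then show ?thesis by (rule UnI1)
        qed
      qed
      have touch: "e \<inter> set xs \<noteq> {}" if e: "e \<in> E" for e
      proof -
        obtain u where u: "u \<in> e" "u \<in> ?W" using conn[OF e] \<open>reach E y \<subseteq> ?W\<close> by blast
        obtain v where v: "e = {u, v}" using card_2_other[of e u] doubleton e u(1) by blast
        then have "v \<in> nbs E u" using e by (simp add: nbs_def)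
        then show ?thesis using u v by auto
      qed
      interpret spanned_cycle E xs "length xs - 1"
        by (intro spanned_cycle.intro spanned_cycle_axioms.intro indexed_cycleI so cyc touch pendant)
      show False using spanned_cycle_coloring[of d S] root neg hd by simp
    qed
  qed
  show ?case
  proof (cases "nbs E y = {}")
    case True
    then have no: "{y, z} \<notin> E" for z by (auto simp: nbs_def)
    show ?thesis
    proof (cases "E = {}")
      case True
      then show ?thesis by (auto simp: rooted_coloring_def injective_on_def)
    next
      case False
      \<comment> \<open>Without an edge at \<open>y\<close> the root conditions are void, so a
        vertex that has an edge can be taken as root instead, with nothing prescribed.\<close>
      then obtain e where "e \<in> E" by blast
      then obtain u v where "{u, v} \<in> E" using doubleton by (metis card_2_iff)
      then have "nbs E u \<noteq> {}" by (auto simp: nbs_def)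
      then obtain c where "rooted_coloring E u 0 {} c" using attached[of u 0 "{}"] by auto
      then show ?thesis using no unfolding rooted_coloring_def by blast
    qed
  next
    case False
    then show ?thesis using attached less.prems by blast
  qed
qed

section \<open>A graph that needs five colours\<close>

text \<open>For \<open>a = b\<close> the three edges form a triangle, otherwise a path; both kinds
  of consecutive edges yield the same inequality.\<close>

lemma injective_edge_coloring_adjacent:
  assumes c: "injective_edge_coloring E k c" and E: "{u, v} \<in> E" "{u, a} \<in> E" "{v, b} \<in> E"
    and neq: "u \<noteq> v" "a \<noteq> v" "b \<noteq> u" "a \<noteq> u" "b \<noteq> v"
  shows "c {u, a} \<noteq> c {v, b}"
proof -
  have E': "{a, u} \<in> E" using E(2) by (simp add: insert_commute)
  have "consecutive E {a, u} {u, v} {v, b}"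
  proof (cases "a = b")
    case True
    have "distinct [a, u, v]" using neq True by auto
    then have "\<exists>x y z. distinct [x, y, z] \<and> {a, u} = {x, y} \<and> {u, v} = {y, z} \<and> {v, b} = {z, x}"
      by - (rule exI[of _ a], rule exI[of _ u], rule exI[of _ v], simp add: True)
    then show ?thesis unfolding consecutive_def using E E' by simp
  next
    case False
    have "distinct [a, u, v, b]" using neq False by auto
    then have "\<exists>x y z w. distinct [x, y, z, w] \<and> {a, u} = {x, y} \<and> {u, v} = {y, z} \<and> {v, b} = {z, w}"
      by - (rule exI[of _ a], rule exI[of _ u], rule exI[of _ v], rule exI[of _ b], simp)
    then show ?thesis unfolding consecutive_def using E E' by simp
  qed
  then have "c {a, u} \<noteq> c {v, b}" using c unfolding injective_edge_coloring_def by blast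
  then show ?thesis by (simp add: insert_commute)
qed

text \<open>The product in the last formula is the height of the segment above the parabola; it
  vanishes only at the two ends.\<close>

lemma segment_parabola:
  fixes i j :: real
  assumes "i < j" "z \<in> closed_segment (Complex i (i\<^sup>2)) (Complex j (j\<^sup>2))"
  shows "i \<le> Re z" "Re z \<le> j" "Im z = (Re z)\<^sup>2 + (Re z - i) * (j - Re z)"
proof -
  obtain u where u: "0 \<le> u" "u \<le> 1" "z = (1 - u) *\<^sub>R Complex i (i\<^sup>2) + u *\<^sub>R Complex j (j\<^sup>2)"
    using assms(2) by (auto simp: in_segment)
  have re: "Re z = i + u * (j - i)" by (subst u(3)) (simp add: algebra_simps)
  have im: "Im z = i\<^sup>2 + u * (j\<^sup>2 - i\<^sup>2)" by (subst u(3)) (simp add: algebra_simps)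
  show "i \<le> Re z" using re u assms(1) by simp
  have "u * (j - i) \<le> 1 * (j - i)" using u assms(1) by (intro mult_right_mono) auto
  then show "Re z \<le> j" using re by simp
  show "Im z = (Re z)\<^sup>2 + (Re z - i) * (j - Re z)"
    unfolding re im by (simp add: algebra_simps power2_eq_square)
qed

text \<open>For nested intervals the difference of the two heights is a sum of three nonnegative
  products, so all three vanish.\<close>

lemma nested_chords_meet:
  fixes i j k l x :: real
  assumes "i \<le> k" "k \<le> x" "x \<le> l" "l \<le> j" "(i, j) \<noteq> (k, l)"
    and eq: "(x - i) * (j - x) = (x - k) * (l - x)"
  shows "x = i \<and> i = k \<or> x = j \<and> j = l"
proof -
  have "(x - k) * (j - l) + (k - i) * (l - x) + (k - i) * (j - l) = 0"
    using eq by (simp add: algebra_simps)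
  moreover have "(x - k) * (j - l) \<ge> 0" "(k - i) * (l - x) \<ge> 0" "(k - i) * (j - l) \<ge> 0"
    using assms by simp_all
  ultimately have "(x - k) * (j - l) = 0" "(k - i) * (l - x) = 0" "(k - i) * (j - l) = 0" by linarith+
  then show ?thesis using assms by auto
qed

text \<open>The vertices are placed on the parabola \<open>y = x\<^sup>2\<close>, and edges are drawn as segments above it.\<close>

lemma noncrossing_outerplanar:
  fixes V :: "nat set" and E :: "nat set set"
  assumes edges: "\<And>e. e \<in> E \<Longrightarrow> e \<subseteq> V \<and> card e = 2"
    and nc: "\<And>i j k l. {i, j} \<in> E \<Longrightarrow> {k, l} \<in> E \<Longrightarrow> i < k \<Longrightarrow> k < j \<Longrightarrow> j < l \<Longrightarrow> False"
  shows "outerplanar V E"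
proof -
  define p where "p = (\<lambda>i::nat. Complex i ((real i)\<^sup>2))"
  define \<gamma> where "\<gamma> = (\<lambda>e. linepath (p (Min e)) (p (Max e)))"
  have Re_p: "Re (p i) = i" and Im_p: "Im (p i) = (real i)\<^sup>2" for i by (simp_all add: p_def)
  have inj: "inj_on p V" by (auto simp: inj_on_def p_def)
  have pair: "\<exists>i j. e = {i, j} \<and> i < j \<and> \<gamma> e = linepath (p i) (p j)" if e: "e \<in> E" for e
  proof -
    obtain i j where "e = {i, j}" "i \<noteq> j" using edges[OF e] by (auto simp: card_2_iff)
    then obtain i j where "e = {i, j}" "i < j" by (metis insert_commute linorder_neqE_nat)
    then show ?thesis by - (rule exI[of _ i], rule exI[of _ j], simp add: \<gamma>_def)
  qed
  have pt: "i \<le> Re z \<and> Re z \<le> j \<and> Im z = (Re z)\<^sup>2 + (Re z - i) * (j - Re z)"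
    if "\<gamma> e = linepath (p i) (p j)" "i < j" "z \<in> path_image (\<gamma> e)" for e i j z
  proof -
    have "z \<in> closed_segment (Complex i ((real i)\<^sup>2)) (Complex j ((real j)\<^sup>2))"
      using that(1,3) unfolding p_def by (simp only: path_image_linepath)
    from segment_parabola[OF _ this] that(2) show ?thesis by simp
  qed
  have at: "z = p i" if "Re z = real i" "Im z = (Re z)\<^sup>2" for z i
    using that by (simp add: p_def complex_eq_iff)
  have ends: "p i \<in> path_image (\<gamma> e)" "p j \<in> path_image (\<gamma> e)" if "\<gamma> e = linepath (p i) (p j)" for e i j
    using that by simp_all
  have meet: "path_image (\<gamma> e) \<inter> path_image (\<gamma> f) \<subseteq> p ` (e \<inter> f)" if ef: "e \<in> E" "f \<in> E" "e \<noteq> f" for e f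
  proof
    fix z assume z: "z \<in> path_image (\<gamma> e) \<inter> path_image (\<gamma> f)"
    obtain i j where e: "e = {i, j}" "i < j" "\<gamma> e = linepath (p i) (p j)" using pair[OF ef(1)] by blast
    obtain k l where f: "f = {k, l}" "k < l" "\<gamma> f = linepath (p k) (p l)" using pair[OF ef(2)] by blast
    have ze: "i \<le> Re z" "Re z \<le> j" "Im z = (Re z)\<^sup>2 + (Re z - i) * (j - Re z)" using pt[OF e(3,2), of z] z by simp_all
    have zf: "k \<le> Re z" "Re z \<le> l" "Im z = (Re z)\<^sup>2 + (Re z - k) * (l - Re z)" using pt[OF f(3,2), of z] z by simp_all
    have "\<exists>n. n \<in> e \<inter> f \<and> Re z = real n"
    proof -
      have "(i, j) \<noteq> (k, l)" using e f ef(3) by auto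
      have "\<not> (i < k \<and> k < j \<and> j < l)" "\<not> (k < i \<and> i < l \<and> l < j)" using nc[of i j k l] nc[of k l i j] ef e f by blast+
      \<comment> \<open>Edges that do not cross span intervals that are nested or share at most an
        end.\<close>
      then consider "j \<le> k" | "l \<le> i" | "i \<le> k" "l \<le> j" | "k \<le> i" "j \<le> l" by linarith
      then show ?thesis
      proof cases
        case 1
        then have "Re z = j" "j = k" using ze zf by linarith+
        then show ?thesis using e f by auto
      next
        case 2
        then have "Re z = i" "i = l" using ze zf by linarith+
        then show ?thesis using e f by auto
      next
        case 3
        have "Re z = i \<and> real i = k \<or> Re z = j \<and> real j = l"
          by (rule nested_chords_meet) (use 3 ze zf \<open>(i, j) \<noteq> (k, l)\<close> in auto)
        then show ?thesis using e f by auto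
      next
        case 4
        have "Re z = k \<and> real k = i \<or> Re z = l \<and> real l = j"
          by (rule nested_chords_meet) (use 4 ze zf \<open>(i, j) \<noteq> (k, l)\<close> in auto)
        then show ?thesis using e f by auto
      qed
    qed
    then obtain n where n: "n \<in> e \<inter> f" "Re z = real n" by blast
    then have "Im z = (Re z)\<^sup>2" using ze(3) e by auto
    then show "z \<in> p ` (e \<inter> f)" using at[of z n] n by blast
  qed
  have draw: "planar_drawing V E p \<gamma>"
    unfolding planar_drawing_def
  proof (intro conjI ballI impI)
    show "inj_on p V" by (rule inj)
  next
    fix e assume e: "e \<in> E"
    obtain i j where ij: "e = {i, j}" "i < j" "\<gamma> e = linepath (p i) (p j)" using pair[OF e] by blast
    have "p i \<noteq> p j" using ij(2) by (simp add: p_def)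
    then show "arc (\<gamma> e)" using ij by (simp add: arc_linepath)
    show "{pathstart (\<gamma> e), pathfinish (\<gamma> e)} = p ` e" using ij by simp
    show "path_image (\<gamma> e) \<inter> p ` V = p ` e"
    proof
      show "p ` e \<subseteq> path_image (\<gamma> e) \<inter> p ` V" using edges[OF e] ij ends by auto
      show "path_image (\<gamma> e) \<inter> p ` V \<subseteq> p ` e"
      proof
        fix z assume "z \<in> path_image (\<gamma> e) \<inter> p ` V"
        then obtain k where k: "z = p k" "z \<in> path_image (\<gamma> e)" by blast
        then have "(real k - i) * (j - real k) = 0" using pt[OF ij(3,2) k(2)] Re_p[of k] Im_p[of k] by simp
        then have "k = i \<or> k = j" by auto
        then show "z \<in> p ` e" using k ij by auto
      qed
    qed
  next
    fix e f assume ef: "e \<in> E" "f \<in> E" "e \<noteq> f"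
    have "p ` (e \<inter> f) \<subseteq> path_image (\<gamma> e) \<inter> path_image (\<gamma> f)"
      using pair[OF ef(1)] pair[OF ef(2)] ends by fastforce
    then show "path_image (\<gamma> e) \<inter> path_image (\<gamma> f) = p ` (e \<inter> f)" using meet[OF ef] by blast
  qed
  let ?D = "drawing_points V E p \<gamma>"
  have above: "(Re z)\<^sup>2 \<le> Im z" if zD: "z \<in> ?D" for z
  proof -
    consider i where "z = p i" | e where "e \<in> E" "z \<in> path_image (\<gamma> e)"
      using zD by (auto simp: drawing_points_def)
    then show ?thesis
    proof cases
      case 1
      then show ?thesis by (simp add: p_def)
    next
      case 2
      obtain i j where "e = {i, j}" "i < j" "\<gamma> e = linepath (p i) (p j)" using pair[OF 2(1)] by blast
      from pt[OF this(3,2) 2(2)] show ?thesis by simp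
    qed
  qed
  \<comment> \<open>The drawing lies on or above the parabola, so the vertical ray downwards from a
    point below it escapes to infinity without meeting the drawing.\<close>
  have below: "z \<in> outside ?D" if z: "Im z < (Re z)\<^sup>2" for z
  proof -
    let ?R = "(\<lambda>t. z - \<i> * of_real t) ` {0..}"
    have "connected ?R" by (intro connected_continuous_image continuous_intros) auto
    moreover have "?R \<subseteq> - ?D" using above z by fastforce
    moreover have "z \<in> ?R" by (rule image_eqI[of _ _ 0]) auto
    ultimately have R: "?R \<subseteq> connected_component_set (- ?D) z"
      by (intro connected_component_maximal)
    have "\<not> bounded ?R"
    proof
      assume "bounded ?R"
      then obtain B where B: "\<And>w. w \<in> ?R \<Longrightarrow> norm w \<le> B" by (auto simp: bounded_iff)
      define t where "t = \<bar>B\<bar> + norm z + 1"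
      have "t \<ge> 0" by (simp add: t_def)
      then have "norm (z - \<i> * of_real t) \<le> B" by (intro B) auto
      moreover have "t - norm z \<le> norm (z - \<i> * of_real t)"
        using norm_triangle_ineq2[of "\<i> * of_real t" z] \<open>t \<ge> 0\<close> by (simp add: norm_minus_commute norm_mult)
      ultimately show False by (simp add: t_def)
    qed
    then show ?thesis using R bounded_subset by (auto simp: outside)
  qed
  have "p i \<in> frontier (outside ?D)" if i: "i \<in> V" for i
  proof -
    have "p i \<in> ?D" using i by (simp add: drawing_points_def)
    then have "p i \<notin> interior (outside ?D)" using outside_no_overlap[of ?D] interior_subset by blast
    moreover have "p i \<in> closure (outside ?D)"
      unfolding closure_approachable
    proof (intro allI impI)
      fix r :: real assume "r > 0"
      then have "p i - \<i> * of_real (r / 2) \<in> outside ?D" by (intro below) (simp add: p_def)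
      moreover have "dist (p i - \<i> * of_real (r / 2)) (p i) < r"
        using \<open>r > 0\<close> by (simp add: dist_norm norm_mult)
      ultimately show "\<exists>w\<in>outside ?D. dist w (p i) < r" by blast
    qed
    ultimately show ?thesis by (simp add: frontier_def)
  qed
  then show ?thesis unfolding outerplanar_def using draw by blast
qed

text \<open>Each half is a triangular prism without one rung: the triangles on 0, 1, 5 and on 2, 3,
  4 are joined by \<open>{1,2}\<close> and \<open>{4,5}\<close>, while the rung from 0 to 3 is
  missing. The free place at 0 takes the bridge to its copy 6; the second half is the first shifted
  by 6. The numbering is such that no two edges cross when drawn over a line.\<close>

definition bridged_gadget :: "nat set set" where
  "bridged_gadget = {{0,1},{1,2},{2,3},{3,4},{4,5},{0,5},{1,5},{2,4},{0,6},
     {6,7},{7,8},{8,9},{9,10},{10,11},{6,11},{7,11},{8,10}}"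

lemma bridged_gadget_edges: "e \<in> bridged_gadget \<Longrightarrow> e \<subseteq> {..11} \<and> card e = 2"
  by (auto simp: bridged_gadget_def)

lemma bridged_gadget_outerplanar: "outerplanar {..11} bridged_gadget"
proof (rule noncrossing_outerplanar[OF bridged_gadget_edges])
  fix i j k l assume "{i, j} \<in> bridged_gadget" "{k, l} \<in> bridged_gadget" "i < k" "k < j" "j < l"
  then show False
    unfolding bridged_gadget_def insert_iff doubleton_eq_iff empty_iff by (elim disjE) simp_all
qed

lemma vertex_degree_empty: "vertex_degree {} v = 0"
  by (simp add: vertex_degree_def)

lemma vertex_degree_insert:
  assumes "finite E" "e \<notin> E"
  shows "vertex_degree (insert e E) v = (if v \<in> e then Suc (vertex_degree E v) else vertex_degree E v)"
proof -
  have "{f \<in> insert e E. v \<in> f} = (if v \<in> e then insert e {f \<in> E. v \<in> f} else {f \<in> E. v \<in> f})"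
    by auto
  then show ?thesis using assms by (simp add: vertex_degree_def)
qed

lemma bridged_gadget_max_degree: "max_degree {..11} bridged_gadget = 3"
proof -
  have "{..11} = {0, 1, 2, 3, 4, 5, 6, 7, 8, 9, 10, 11::nat}"
    by (auto simp: atMost_nat_numeral atMost_Suc)
  then have le: "\<forall>v\<in>{..11}. vertex_degree bridged_gadget v \<le> 3"
    by (simp only: ball_simps)
      (simp add: bridged_gadget_def vertex_degree_insert vertex_degree_empty doubleton_eq_iff)
  have eq: "vertex_degree bridged_gadget 0 = 3"
    by (simp add: bridged_gadget_def vertex_degree_insert vertex_degree_empty doubleton_eq_iff)
  show ?thesis
    unfolding max_degree_def
  proof (rule antisym)
    show "(SUP v\<in>{..11}. vertex_degree bridged_gadget v) \<le> 3"
      by (rule cSUP_least) (use le in auto)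
    have "vertex_degree bridged_gadget 0 \<le> (SUP v\<in>{..11}. vertex_degree bridged_gadget v)"
      by (rule cSUP_upper) auto
    then show "3 \<le> (SUP v\<in>{..11}. vertex_degree bridged_gadget v)" using eq by simp
  qed
qed

text \<open>If the bridge differed from both edges, it would show all four colours together with the
  triangle at \<open>s\<close>. On the far triangle this forces \<open>?h = ?d\<close>, then
  \<open>?x = ?f\<close> and \<open>?t = ?e\<close>. Both connecting edges are left with the colour
  \<open>?g\<close>, but they conflict across \<open>{s + 1, s + 5}\<close>.\<close>

lemma gadget_forces:
  fixes c :: "nat set \<Rightarrow> nat"
  assumes c: "injective_edge_coloring E k c" and k: "k \<le> 4"
    and E: "{s, s + 1} \<in> E" "{s + 1, s + 2} \<in> E" "{s + 2, s + 3} \<in> E" "{s + 3, s + 4} \<in> E" "{s + 4, s + 5} \<in> E"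
      "{s, s + 5} \<in> E" "{s + 1, s + 5} \<in> E" "{s + 2, s + 4} \<in> E" "{s, w} \<in> E"
    and w: "w \<notin> {s..s + 5}"
  shows "c {s, w} \<in> {c {s, s + 1}, c {s, s + 5}}"
proof (rule ccontr)
  assume neg: "\<not> ?thesis"
  have comm: "{s + 1, s} \<in> E" "{s + 2, s + 1} \<in> E" "{s + 3, s + 2} \<in> E" "{s + 4, s + 3} \<in> E" "{s + 5, s + 4} \<in> E"
      "{s + 5, s} \<in> E" "{s + 5, s + 1} \<in> E" "{s + 4, s + 2} \<in> E"
    using E by (simp_all add: insert_commute)
  note conf = injective_edge_coloring_adjacent[OF c]
  \<comment> \<open>\<open>?d\<close> belongs to the bridge, \<open>?e\<close>, \<open>?f\<close>,
    \<open>?g\<close> to the triangle at \<open>s\<close>, \<open>?p\<close> and \<open>?q\<close>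
    to the connecting edges, and \<open>?h\<close>, \<open>?x\<close>, \<open>?t\<close> to the
    other triangle.\<close>
  let ?d = "c {s, w}" and ?e = "c {s, s + 1}" and ?f = "c {s, s + 5}" and ?g = "c {s + 1, s + 5}"
    and ?p = "c {s + 1, s + 2}" and ?q = "c {s + 4, s + 5}" and ?h = "c {s + 2, s + 4}"
    and ?x = "c {s + 2, s + 3}" and ?t = "c {s + 3, s + 4}"
  have ws: "w \<noteq> s" "w \<noteq> s + 1" "w \<noteq> s + 5" using w by auto
  have 1: "?f \<noteq> ?g" "?f \<noteq> ?p" "?d \<noteq> ?g" "?d \<noteq> ?p"
    using conf[OF E(1) E(6) E(7)] conf[OF E(1) E(6) E(2)] conf[OF E(1) E(9) E(7)] conf[OF E(1) E(9) E(2)] ws by auto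
  have 2: "?e \<noteq> ?g" "?e \<noteq> ?q" "?d \<noteq> ?q"
    using conf[OF E(6) E(1) comm(7)] conf[OF E(6) E(1) comm(5)] conf[OF E(6) E(9) comm(5)] ws
    by (auto simp: insert_commute)
  have 3: "?e \<noteq> ?f" "?p \<noteq> ?q"
    using conf[OF E(7) comm(1) comm(6)] conf[OF E(7) E(2) comm(5)] by (auto simp: insert_commute)
  have 4: "?e \<noteq> ?h" "?e \<noteq> ?x" "?g \<noteq> ?h" "?g \<noteq> ?x"
    using conf[OF E(2) comm(1) E(8)] conf[OF E(2) comm(1) E(3)] conf[OF E(2) E(7) E(8)] conf[OF E(2) E(7) E(3)]
    by (auto simp: insert_commute)
  have 5: "?h \<noteq> ?f" "?t \<noteq> ?f" "?h \<noteq> ?g" "?t \<noteq> ?g"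
    using conf[OF E(5) comm(8) comm(6)] conf[OF E(5) comm(4) comm(6)] conf[OF E(5) comm(8) comm(7)] conf[OF E(5) comm(4) comm(7)]
    by (auto simp: insert_commute)
  have 6: "?p \<noteq> ?t" "?x \<noteq> ?q" "?x \<noteq> ?t"
    using conf[OF E(8) comm(2) comm(4)] conf[OF E(8) E(3) E(5)] conf[OF E(8) E(3) comm(4)]
    by (auto simp: insert_commute)
  have 7: "?h \<noteq> ?t" "?x \<noteq> ?h"
    using conf[OF E(3) E(8) E(4)] conf[OF E(4) comm(3) comm(8)] by (auto simp: insert_commute)
  have col: "c ` E \<subseteq> {1..4}" using c k by (fastforce simp: injective_edge_coloring_def Pi_iff)
  have "{?d, ?e, ?f, ?g} = {1..4}"
  proof (rule card_subset_eq)
    show "{?d, ?e, ?f, ?g} \<subseteq> {1..4}" using col E by blast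
    show "card {?d, ?e, ?f, ?g} = card {1..4::nat}" using neg 1 2 3 by simp
  qed simp
  then have "c ` E \<subseteq> {?d, ?e, ?f, ?g}" using col by simp
  then have "?p \<in> {?d, ?e, ?f, ?g}" "?q \<in> {?d, ?e, ?f, ?g}" "?h \<in> {?d, ?e, ?f, ?g}"
    "?x \<in> {?d, ?e, ?f, ?g}" "?t \<in> {?d, ?e, ?f, ?g}" using E by blast+
  then have "?p = ?e \<or> ?p = ?g" "?q = ?f \<or> ?q = ?g" "?h = ?d" "?x = ?d \<or> ?x = ?f" "?t = ?d \<or> ?t = ?e"
    using 1 2 4 5 by auto
  then have "?x = ?f" "?t = ?e" using 7 by auto
  then have "?p = ?g" "?q = ?g" using 6 \<open>?p = ?e \<or> ?p = ?g\<close> \<open>?q = ?f \<or> ?q = ?g\<close> by auto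
  then show False using 3 by simp
qed

lemma bridged_gadget_not_4_colorable:
  assumes "injective_edge_coloring bridged_gadget k c"
  shows "5 \<le> k"
proof (rule ccontr)
  assume "\<not> 5 \<le> k"
  then have k: "k \<le> 4" by simp
  have "c {0, 6} \<in> {c {0, 0 + 1}, c {0, 0 + 5}}"
    by (rule gadget_forces[OF assms k]) (simp_all add: bridged_gadget_def doubleton_eq_iff)
  moreover have "c {6, 0} \<in> {c {6, 6 + 1}, c {6, 6 + 5}}"
    by (rule gadget_forces[OF assms k]) (simp_all add: bridged_gadget_def doubleton_eq_iff)
  ultimately have "c {0, 6} = c {0, 1} \<or> c {0, 6} = c {0, 5}" "c {0, 6} = c {6, 7} \<or> c {0, 6} = c {6, 11}"
    by (simp_all add: insert_commute)
  \<comment> \<open>The bridge is the middle edge between any two of these, so its colour cannot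
    recur at both of its ends.\<close>
  moreover have "c {0, 1} \<noteq> c {6, 7}" "c {0, 1} \<noteq> c {6, 11}" "c {0, 5} \<noteq> c {6, 7}" "c {0, 5} \<noteq> c {6, 11}"
    by (rule injective_edge_coloring_adjacent[OF assms, of 0 6]; simp add: bridged_gadget_def)+
  ultimately show False by auto
qed

section \<open>The injective chromatic index of outerplanar graphs\<close>

lemma card_nbs:
  assumes "\<forall>e\<in>E. card e = 2"
  shows "card (nbs E v) = vertex_degree E v"
  unfolding vertex_degree_def
proof (rule bij_betw_same_card)
  show "bij_betw (\<lambda>u. {v, u}) (nbs E v) {e \<in> E. v \<in> e}"
  proof (rule bij_betwI')
    show "\<exists>u\<in>nbs E v. e = {v, u}" if "e \<in> {e \<in> E. v \<in> e}" for e
      using that card_2_other[of e v] assms by (auto simp: nbs_def)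
  qed (auto simp: nbs_def doubleton_eq_iff)
qed

lemma outerplanar_subcubic_outer:
  assumes "fin_simple_graph V E" "outerplanar V E" "max_degree V E \<le> 3"
  shows "subcubic_outer E"
proof -
  interpret fin_simple_graph V E by fact
  obtain p \<gamma> where "planar_drawing V E p \<gamma>" "p ` V \<subseteq> frontier (outside (drawing_points V E p \<gamma>))"
    using assms(2) unfolding outerplanar_def by blast
  then interpret outer_drawing V E p \<gamma>
    by (rule outer_drawing.intro) (use edges in blast)
  have doubleton: "\<forall>e\<in>E. card e = 2" using edges by blast
  have "card (nbs E v) \<le> 3" for v
  proof (cases "v \<in> V")
    case True
    have "vertex_degree E v \<le> max_degree V E"
      unfolding max_degree_def using True finite_vertices by (intro cSUP_upper) auto
    then show ?thesis using assms(3) card_nbs[OF doubleton] by simp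
  next
    case False
    then have "nbs E v = {}" using edges by (auto simp: nbs_def)
    then show ?thesis by simp
  qed
  moreover have "theta_free E" unfolding theta_free_def using no_theta by blast
  moreover have "crossing_free E" unfolding crossing_free_def using no_crossing by blast
  ultimately show ?thesis using finite_edges doubleton by (simp add: subcubic_outer_def)
qed

lemma injective_on_consecutive:
  assumes "injective_on E c" "consecutive E e1 e2 e3"
  shows "c e1 \<noteq> c e3"
proof -
  obtain a b x d where e: "e1 = {a, b}" "e2 = {b, x}" "e3 = {x, d}" and ne: "a \<noteq> x" "d \<noteq> b"
    using assms(2) unfolding consecutive_def by (auto 4 4)
  have "{b, x} \<in> E" "{b, a} \<in> E" "{x, d} \<in> E"
    using assms(2) e unfolding consecutive_def by (simp_all add: insert_commute)
  then have "c {b, a} \<noteq> c {x, d}" using injective_onD[OF assms(1)] ne by blast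
  then show ?thesis using e by (simp add: insert_commute)
qed

lemma ex_injective_edge_coloring_5:
  assumes "fin_simple_graph V E" "outerplanar V E" "max_degree V E \<le> 3"
  shows "\<exists>c. injective_edge_coloring E 5 c"
proof -
  \<comment> \<open>With \<open>d = 0\<close> and \<open>S = {}\<close> the root carries no
    condition, so any element of the type may stand for it.\<close>
  obtain c where "rooted_coloring E undefined 0 {} c"
    using ex_rooted_coloring[OF outerplanar_subcubic_outer[OF assms], of undefined 0 "{}"] by auto
  then have "injective_edge_coloring E 5 c"
    unfolding injective_edge_coloring_def rooted_coloring_def using injective_on_consecutive by blast
  then show ?thesis by blast
qed

lemma injective_chromatic_index_le: "injective_edge_coloring E k c \<Longrightarrow> injective_chromatic_index E \<le> k"
  unfolding injective_chromatic_index_def by (intro Least_le) blast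

theorem theorem1p19:
  "(\<forall>(V :: 'a set) E. fin_simple_graph V E \<and> outerplanar V E \<and> max_degree V E = 3 \<longrightarrow>
      injective_chromatic_index E \<le> 5) \<and>
   (\<exists>(V :: nat set) E. fin_simple_graph V E \<and> outerplanar V E \<and> max_degree V E = 3 \<and>
      injective_chromatic_index E = 5)"
proof (intro conjI allI impI)
  fix V :: "'a set" and E
  assume "fin_simple_graph V E \<and> outerplanar V E \<and> max_degree V E = 3"
  then show "injective_chromatic_index E \<le> 5"
    using ex_injective_edge_coloring_5[of V E] injective_chromatic_index_le by auto
next
  have graph: "fin_simple_graph {..11} bridged_gadget"
    using bridged_gadget_edges by unfold_locales auto
  have "injective_chromatic_index bridged_gadget \<le> 5"
    using ex_injective_edge_coloring_5[OF graph bridged_gadget_outerplanar] bridged_gadget_max_degree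
      injective_chromatic_index_le by auto
  moreover have "5 \<le> injective_chromatic_index bridged_gadget"
    using fin_simple_graph.injective_chromatic_index_attained[OF graph] bridged_gadget_not_4_colorable by blast
  ultimately show "\<exists>(V :: nat set) E. fin_simple_graph V E \<and> outerplanar V E \<and> max_degree V E = 3 \<and>
      injective_chromatic_index E = 5"
    using graph bridged_gadget_outerplanar bridged_gadget_max_degree
    by (intro exI[of _ "{..11}"] exI[of _ bridged_gadget]) simp
qed

end
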